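(* Suppose that $f \in \mathcal{C}^2(\mathbb{R}^m\times\mathbb{R}^n, \mathbb{R})$ is globally strongly convex--concave, and there exist $\beta_G \geq \alpha_G > 0$ and $\beta_H \geq \alpha_H > 0$ such that for all $(x,y)\in\mathbb{R}^m\times\mathbb{R}^n$: (1) $\beta_H \succcurlyeq \sqrt{H_{x,x}^*}^{-1} H_{x,x}(x, y) \sqrt{H_{x,x}^*}^{-1} \succcurlyeq \alpha_H$; (2) $\beta_H \succcurlyeq \sqrt{-H_{y,y}^*}^{-1} (-H_{y,y}(x, y)) \sqrt{-H_{y,y}^*}^{-1} \succcurlyeq \alpha_H$; (3) $\beta_G \succcurlyeq \sqrt{H_{x,x}^*}^{-1} G_{x,x}(x, y) \sqrt{H_{x,x}^*}^{-1} \succcurlyeq \alpha_G$; (4) $\beta_G \succcurlyeq \sqrt{-H_{y,y}^*}^{-1} G_{y,y}(x, y) \sqrt{-H_{y,y}^*}^{-1} \succcurlyeq \alpha_G$, where $H_{x,x}^* = H_{x,x}(x^*, y^* )$, $H_{y,y}^* = H_{y,y}(x^*, y^* )$ and $(x^*, y^* )$ is the global min--max saddle point of $f$. Consider the iteration $$x_{t+1} = x_t + \eta\cdot(\tilde{x}_t - x_t),\qquad y_{t+1} = y_t + \eta\cdot(\tilde{y}_t - y_t),$$ with learning rate $\eta>0$, where $\tilde{x}_t = \mathcal{M}_{x}(f(\cdot, y_t), x_t)$ and $\tilde{y}_t = \mathcal{M}_{y}(-f(x_t, \cdot), y_t)$, and $\mathcal{M}_x$ and $\mathcal{M}_y$ are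 approximate minimization oracles with approximation precision parameter $\epsilon\in[0,1)$ satisfying $\epsilon < \frac{\alpha_H^5}{\beta_H^4 \beta_G}$. Let $$\eta^* = \frac{\alpha_H}{\beta_H}\frac{\alpha_H}{\beta_G} \frac{1 - (\beta_H/\alpha_H)^2 \sqrt{(\beta_G / \alpha_H) \cdot \epsilon}}{(1 + \sqrt{\epsilon})^2},$$ $$\gamma = - 2 \eta \frac{\alpha_{H}}{\beta_{H}} \left( 1 - \frac{\beta_H^2}{\alpha_H^2} \sqrt{\frac{\beta_G}{\alpha_{H}} \cdot \epsilon } \right) + \eta^2 \cdot (1 + \sqrt{\epsilon})^2 \cdot \frac{\beta_{G}}{\alpha_H}.$$ Then, for any $\eta < 2 \cdot \eta^*$, we have $\gamma < 0$ and $$\log\left( G(x_{t+1}, y_{t+1}) \right) - \log\left( G(x_{t}, y_{t}) \right) < \gamma.$$ In other words, the runtime $T_{\zeta}$ (number of iterations) to reach $\{(x, y) \in \mathbb{R}^m \times \mathbb{R}^n : G(x, y) \leq \zeta \cdot G(x_{0}, y_{0}) \}$ for $\zeta \in (0, 1)$ satisfies $$T_{\zeta} \leq \left\lceil \frac{1}{|\gamma|} \log\left(\frac{1}{\zeta}\right) \right\rceil$$ for any initial point $(x_0, y_0) \in \mathbb{R}^m\times\mathbb{R}^n$. Moreover, $G(x_{t+1}, y_{t+1}) > G(x_t, y_t)$ for all $(x_t, y_t)$ if $\eta > 2 \cdot \bar{\eta}$, where $$\bar{\eta} = \frac{\beta_H}{\alpha_G}\frac{\beta_H}{\alpha_H}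 \frac{1 + \sqrt{(\beta_G / \alpha_H) \cdot \epsilon}}{\left( 1 - \sqrt{(\beta_H/ \alpha_H) \cdot \epsilon}\right)^2}.$$
   Context: For $f \in \mathcal{C}^2(\mathbb{R}^m\times\mathbb{R}^n, \mathbb{R})$, $H_{x,x}(x,y)$, $H_{x,y}(x,y)$, $H_{y,x}(x,y)$, $H_{y,y}(x,y)$ denote the blocks of the Hessian matrix $\nabla^2 f(x,y)$, with $(i,j)$-th components $\frac{\partial^2 f}{\partial x_i\partial x_j}$, $\frac{\partial^2 f}{\partial x_i\partial y_j}$, $\frac{\partial^2 f}{\partial y_i\partial x_j}$, $\frac{\partial^2 f}{\partial y_i\partial y_j}$ evaluated at $(x,y)$. For symmetric matrices, $A\succcurlyeq B$ means that $A-B$ is non-negative definite; for a real number $a$, $A\succcurlyeq a$ means $A\succcurlyeq a I$, and $a\succcurlyeq A$ means $aI\succcurlyeq A$. For a positive definite symmetric $A$, $\sqrt{A}$ is the positive definite symmetric matrix with $A=\sqrt{A}\sqrt{A}$, and $\sqrt{A}^{-1}$ is its inverse. $f$ is globally $\mu$-strongly convex--concave ($\mu>0$) if $H_{x,x}(x,y)\succcurlyeq\mu$ and $-H_{y,y}(x,y)\succcurlyeq\mu$ for all $(x,y)\in\mathbb{R}^m\times\mathbb{R}^n$, where $f$ is understood to have a critical point $(x^*,y^* )$, i.e. $\nabla f(x^*,y^* )=0$. It is globally strongly convex--concave if this holds for some $\mu>0$. The global min--max saddle point $(x^*,y^* )$ satisfies $f(x,y^* )\geq f(x^*,y^* )\geq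 f(x^*,y)$ for all $(x,y)\in\mathbb{R}^m\times\mathbb{R}^n$. The matrices $G_{x,x}$ and $G_{y,y}$ are $$G_{x,x}(x, y) = H_{x,x}(x, y) + H_{x,y}(x, y)(- H_{y,y}(x, y) )^{-1} H_{y,x}(x, y),$$ $$G_{y,y}(x, y) = - H_{y,y}(x, y ) + H_{y,x}(x, y)(H_{x,x}(x, y))^{-1} H_{x,y}(x, y).$$ The suboptimality error is $G(x,y)=\max_{y'\in\mathbb{R}^n}f(x,y')-\min_{x'\in\mathbb{R}^m}f(x',y)$. An approximate minimization oracle $\mathcal{M}$ takes an objective function $h:\mathbb{Z}\to\mathbb{R}$ to be minimized and a reference solution $\bar z\in\mathbb{Z}$, and outputs $\tilde z=\mathcal{M}(h,\bar z)\in\mathbb{Z}$ satisfying $h(\tilde z)<h(\bar z)$ unless $\bar z$ is a local minimal point of $h$. It has approximation precision parameter $\epsilon\in[0,1)$ if moreover its output satisfies $$h(\tilde z)-\min_{z\in\mathbb{Z}}h(z)\leq\epsilon\cdot\left(h(\bar z)-\min_{z\in\mathbb{Z}}h(z)\right).$$ Here $\mathcal{M}_x$ is such an oracle for the problems $h=f(\cdot,y)$ on $\mathbb{Z}=\mathbb{R}^m$ for every $y\in\mathbb{R}^n$, and $\mathcal{M}_y$ is such an oracle for the problems $h=-f(x,\cdot)$ on $\mathbb{Z}=\mathbb{R}^n$ for every $x\in\mathbb{R}^m$.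
   Formalization: The one-step claims are stated for (x_t, y_t) different from the saddle point (x*, y* ), where G = 0, the iteration stays put, log G is undefined and the strict increase fails; log 0 is read as minus infinity for G(x_{t+1}, y_{t+1}). *)

theory Defs
  imports "HOL-Analysis.Analysis" "HOL-Library.Extended_Nat"
begin

text \<open>The second derivative is an element of \<open>L(E, L(E, \<real>))\<close> and is continuous for the operator norm.\<close>

definition twice_continuously_differentiable :: "('a::real_normed_vector \<Rightarrow> real) \<Rightarrow> bool" where
  "twice_continuously_differentiable f \<longleftrightarrow>
     (\<exists>(f' :: 'a \<Rightarrow> 'a \<Rightarrow>\<^sub>L real) (f'' :: 'a \<Rightarrow> 'a \<Rightarrow>\<^sub>L 'a \<Rightarrow>\<^sub>L real).
        (\<forall>z. (f has_derivative blinfun_apply (f' z)) (at z)) \<and>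
        (\<forall>z. (f' has_derivative blinfun_apply (f'' z)) (at z)) \<and>
        continuous_on UNIV f'')"

definition partial_deriv :: "'a::real_normed_vector \<Rightarrow> ('a \<Rightarrow> real) \<Rightarrow> 'a \<Rightarrow> real" where
  "partial_deriv b f z = deriv (\<lambda>t. f (z + t *\<^sub>R b)) 0"

type_synonym ('m, 'n) point = "(real ^ 'm) \<times> (real ^ 'n)"

definition ex :: "'m::finite \<Rightarrow> ('m, 'n::finite) point" where
  "ex i = (axis i 1, 0)"

definition ey :: "'n::finite \<Rightarrow> ('m::finite, 'n) point" where
  "ey j = (0, axis j 1)"

definition Hxx :: "(('m::finite, 'n::finite) point \<Rightarrow> real) \<Rightarrow> real ^ 'm \<Rightarrow> real ^ 'n \<Rightarrow> real ^ 'm ^ 'm" where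
  "Hxx f x y = (\<chi> i j. partial_deriv (ex i) (partial_deriv (ex j) f) (x, y))"

definition Hxy :: "(('m::finite, 'n::finite) point \<Rightarrow> real) \<Rightarrow> real ^ 'm \<Rightarrow> real ^ 'n \<Rightarrow> real ^ 'n ^ 'm" where
  "Hxy f x y = (\<chi> i j. partial_deriv (ex i) (partial_deriv (ey j) f) (x, y))"

definition Hyx :: "(('m::finite, 'n::finite) point \<Rightarrow> real) \<Rightarrow> real ^ 'm \<Rightarrow> real ^ 'n \<Rightarrow> real ^ 'm ^ 'n" where
  "Hyx f x y = (\<chi> i j. partial_deriv (ey i) (partial_deriv (ex j) f) (x, y))"

definition Hyy :: "(('m::finite, 'n::finite) point \<Rightarrow> real) \<Rightarrow> real ^ 'm \<Rightarrow> real ^ 'n \<Rightarrow> real ^ 'n ^ 'n" where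
  "Hyy f x y = (\<chi> i j. partial_deriv (ey i) (partial_deriv (ey j) f) (x, y))"

definition Gxx :: "(('m::finite, 'n::finite) point \<Rightarrow> real) \<Rightarrow> real ^ 'm \<Rightarrow> real ^ 'n \<Rightarrow> real ^ 'm ^ 'm" where
  "Gxx f x y = Hxx f x y + Hxy f x y ** matrix_inv (- Hyy f x y) ** Hyx f x y"

definition Gyy :: "(('m::finite, 'n::finite) point \<Rightarrow> real) \<Rightarrow> real ^ 'm \<Rightarrow> real ^ 'n \<Rightarrow> real ^ 'n ^ 'n" where
  "Gyy f x y = - Hyy f x y + Hyx f x y ** matrix_inv (Hxx f x y) ** Hxy f x y"

definition nonneg_definite :: "real ^ 'n ^ 'n \<Rightarrow> bool" where
  "nonneg_definite A \<longleftrightarrow> transpose A = A \<and> (\<forall>v. 0 \<le> v \<bullet> (A *v v))"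

definition pos_definite :: "real ^ 'n ^ 'n \<Rightarrow> bool" where
  "pos_definite A \<longleftrightarrow> transpose A = A \<and> (\<forall>v. v \<noteq> 0 \<longrightarrow> 0 < v \<bullet> (A *v v))"

text \<open>A scalar \<open>a\<close> in a matrix inequality is written as \<open>mat a\<close>, i.e. \<open>a\<close> times the identity.\<close>

definition loewner_ge :: "real ^ 'n ^ 'n \<Rightarrow> real ^ 'n ^ 'n \<Rightarrow> bool" (infix \<open>\<succeq>\<close> 50) where
  "A \<succeq> B \<longleftrightarrow> nonneg_definite (A - B)"

text \<open>Meaningful for positive definite symmetric \<open>A\<close> only.\<close>

definition matrix_sqrt :: "real ^ 'n ^ 'n \<Rightarrow> real ^ 'n ^ 'n" where
  "matrix_sqrt A = (THE S. pos_definite S \<and> A = S ** S)"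

definition isqrt :: "real ^ 'n ^ 'n \<Rightarrow> real ^ 'n ^ 'n" where
  "isqrt A = matrix_inv (matrix_sqrt A)"

definition strongly_convex_concave :: "real \<Rightarrow> (('m::finite, 'n::finite) point \<Rightarrow> real) \<Rightarrow> bool" where
  "strongly_convex_concave \<mu> f \<longleftrightarrow>
     (\<exists>z. GDERIV f z :> 0) \<and>
     (\<forall>x y. Hxx f x y \<succeq> mat \<mu> \<and> - Hyy f x y \<succeq> mat \<mu>)"

definition globally_strongly_convex_concave :: "(('m::finite, 'n::finite) point \<Rightarrow> real) \<Rightarrow> bool" where
  "globally_strongly_convex_concave f \<longleftrightarrow> (\<exists>\<mu>>0. strongly_convex_concave \<mu> f)"

definition global_min_max_saddle :: "('a \<times> 'b \<Rightarrow> real) \<Rightarrow> 'a \<Rightarrow> 'b \<Rightarrow> bool" where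
  "global_min_max_saddle f xs ys \<longleftrightarrow>
     (\<forall>x y. f (x, ys) \<ge> f (xs, ys) \<and> f (xs, ys) \<ge> f (xs, y))"

text \<open>For a globally strongly convex--concave \<open>f\<close> the supremum and the infimum are attained,
  so they are the maximum and the minimum; likewise for the minimum in the oracle condition below,
  which is imposed only on objective functions of the form \<open>f(\<cdot>, y)\<close> and \<open>-f(x, \<cdot>)\<close>.\<close>

definition subopt_error :: "('a \<times> 'b \<Rightarrow> real) \<Rightarrow> 'a \<Rightarrow> 'b \<Rightarrow> real" where
  "subopt_error f x y = (SUP y'. f (x, y')) - (INF x'. f (x', y))"

definition is_local_min :: "('a::topological_space \<Rightarrow> real) \<Rightarrow> 'a \<Rightarrow> bool" where
  "is_local_min h z \<longleftrightarrow> (\<forall>\<^sub>F z' in nhds z. h z \<le> h z')"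

definition approx_min_oracle ::
    "('a::topological_space \<Rightarrow> real) set \<Rightarrow> (('a \<Rightarrow> real) \<Rightarrow> 'a \<Rightarrow> 'a) \<Rightarrow> bool" where
  "approx_min_oracle \<H> M \<longleftrightarrow>
     (\<forall>h\<in>\<H>. \<forall>z. \<not> is_local_min h z \<longrightarrow> h (M h z) < h z)"

definition approx_min_oracle_precision ::
    "real \<Rightarrow> ('a::topological_space \<Rightarrow> real) set \<Rightarrow> (('a \<Rightarrow> real) \<Rightarrow> 'a \<Rightarrow> 'a) \<Rightarrow> bool" where
  "approx_min_oracle_precision \<epsilon> \<H> M \<longleftrightarrow>
     approx_min_oracle \<H> M \<and>
     (\<forall>h\<in>\<H>. \<forall>z. h (M h z) - (INF z'. h z') \<le> \<epsilon> * (h z - (INF z'. h z')))"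

text \<open>Logarithm with \<open>log 0 = -\<infinity>\<close>, needed because the error may vanish after one step
  while HOL's \<open>ln 0\<close> is \<open>0\<close>.\<close>

definition elog :: "real \<Rightarrow> ereal" where
  "elog r = (if r \<le> 0 then - \<infinity> else ereal (ln r))"

text \<open>The first time at which a sequence is in \<open>S\<close>; it is \<open>\<infinity>\<close> if there is none.\<close>

definition hitting_time :: "'a set \<Rightarrow> (nat \<Rightarrow> 'a) \<Rightarrow> enat" where
  "hitting_time S z = (INF t\<in>{t. z t \<in> S}. enat t)"

end

theory Submission
  imports Defs
begin

text \<open>Write \<open>F(x) = max\<^sub>v f(x, v)\<close> with maximiser \<open>v(x)\<close>, and \<open>D(y) = - min\<^sub>u f(u, y)\<close> with minimiser \<open>u(y)\<close>,
  so that the suboptimality error is \<open>F + D\<close>. By the envelope theorem \<open>\<nabla>F(x) = \<nabla>\<^sub>x f(x, v(x))\<close>, and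
  the Hessian of \<open>F\<close> is the Schur complement \<open>G\<^sub>x\<^sub>x\<close>, so \<open>F\<close> has quadratic upper and lower bounds
  with constants \<open>\<beta>\<^sub>G\<close> and \<open>\<alpha>\<^sub>G\<close> in the norm given by the square root of the Hessian block at the saddle
  point; \<open>D\<close> is the same object for \<open>(v, u) \<mapsto> - f(u, v)\<close>. In the first-order term for the exact
  steps \<open>u(y) - x\<close> and \<open>v(x) - y\<close>, convexity and concavity leave \<open>f(u(y), v(x)) - F(x)\<close> and
  \<open>- f(u(y), v(x)) - D(y)\<close>, which sum to minus the error. The oracle error enters through
  \<open>\<bar>\<nabla>F \<bullet> e\<bar>\<^sup>2 \<le> 2 \<beta>\<^sub>G (F - min F) \<bar>e\<bar>\<^sup>2\<close>, the bound \<open>\<bar>e\<bar>\<^sup>2 \<le> (2 / \<alpha>\<^sub>H) \<epsilon> \<cdot> gap\<close> and \<open>2 sqrt (p q) \<le> p + q\<close>.\<close>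

section \<open>Partial maximisation of a strongly concave function\<close>

text \<open>Lagrange form of the remainder. The place of the intermediate point is forgotten,
  because the Hessian bounds applied to it later hold everywhere.\<close>

lemma Taylor_order2_unit_interval:
  fixes \<phi> \<phi>' \<phi>'' :: "real \<Rightarrow> real"
  assumes "\<And>t. (\<phi> has_real_derivative \<phi>' t) (at t)"
    and "\<And>t. (\<phi>' has_real_derivative \<phi>'' t) (at t)"
  shows "\<exists>t. \<phi> 1 = \<phi> 0 + \<phi>' 0 + \<phi>'' t / 2"
proof -
  define D where "D n = (if n = 0 then \<phi> else if n = 1 then \<phi>' else \<phi>'')" for n :: nat
  have "\<exists>t. 0 < t \<and> t < 1 \<and>
      \<phi> 1 = (\<Sum>m<2. D m 0 / fact m * 1 ^ m) + D 2 t / fact 2 * 1 ^ 2"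
    by (rule Maclaurin) (use assms in \<open>auto simp: D_def less_2_cases_iff\<close>)
  then show ?thesis
    by (auto simp: D_def numeral_2_eq_2)
qed

text \<open>A parabola without negative values has no positive discriminant. Applied to a quadratic
  majorant of a function bounded below, this bounds a gradient, see
  \<open>maxgrad_bound\<close>.\<close>

lemma quadratic_form_nonneg_imp_discriminant:
  fixes a b c :: real
  assumes nonneg: "\<And>t. 0 \<le> a + b * t + c * t\<^sup>2 / 2" and "0 \<le> c"
  shows "b\<^sup>2 \<le> 2 * a * c"
proof (cases "c = 0")
  case True
  show ?thesis
  proof (cases "b = 0")
    case False
    \<comment> \<open>At this point the affine function would take the value -1.\<close>
    then show ?thesis using nonneg[of "(- a - 1) / b"] True by simp
  qed (use True in simp)
next
  case False
  \<comment> \<open>The vertex of the parabola.\<close>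
  then show ?thesis using nonneg[of "- b / c"] \<open>0 \<le> c\<close>
    by (simp add: field_simps power2_eq_square)
qed

lemma line_has_vector_derivative:
  "((\<lambda>t. p + t *\<^sub>R d) has_vector_derivative d) (at t)" for p d :: "'a::real_normed_vector"
  by (auto intro!: derivative_eq_intros)

section \<open>Chain rule and Taylor formula for a function with a gradient and a Hessian\<close>

locale gradient_hessian =
  fixes f :: "'c::euclidean_space \<Rightarrow> real" and g :: "'c \<Rightarrow> 'c" and H :: "'c \<Rightarrow> 'c \<Rightarrow> 'c"
  assumes has_gradient: "(f has_derivative (\<lambda>h. g z \<bullet> h)) (at z)"
    and has_hessian: "(g has_derivative H z) (at z)"
begin

lemma linear_H: "linear (H z)"
  using has_hessian by (rule has_derivative_linear)

text \<open>Stated for arbitrary curves, since it serves both straight lines and the curve formed by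
  a moving point and its maximiser.\<close>

lemma has_derivative_along:
  assumes "(c has_vector_derivative w) (at t)"
  shows "((\<lambda>t. f (c t)) has_real_derivative g (c t) \<bullet> w) (at t)"
    and "((\<lambda>t. g (c t)) has_vector_derivative H (c t) w) (at t)"
    and "((\<lambda>t. g (c t) \<bullet> k) has_real_derivative H (c t) w \<bullet> k) (at t)"
proof -
  have c: "(c has_derivative (\<lambda>h. h *\<^sub>R w)) (at t)"
    using assms by (simp add: has_vector_derivative_def)
  have "((\<lambda>t. f (c t)) has_derivative (\<lambda>h. g (c t) \<bullet> (h *\<^sub>R w))) (at t)"
    by (rule has_derivative_compose[OF c has_gradient])
  then show "((\<lambda>t. f (c t)) has_real_derivative g (c t) \<bullet> w) (at t)"
    by (simp add: has_field_derivative_def mult_commute_abs)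
  have "((\<lambda>t. g (c t)) has_derivative (\<lambda>h. H (c t) (h *\<^sub>R w))) (at t)"
    by (rule has_derivative_compose[OF c has_hessian])
  then show 1: "((\<lambda>t. g (c t)) has_vector_derivative H (c t) w) (at t)"
    by (simp add: has_vector_derivative_def linear_cmul[OF linear_H])
  have "((\<lambda>t. g (c t) \<bullet> k) has_derivative (\<lambda>h. (h *\<^sub>R H (c t) w) \<bullet> k)) (at t)"
    by (rule has_derivative_inner_left) (use 1 in \<open>simp add: has_vector_derivative_def\<close>)
  then show "((\<lambda>t. g (c t) \<bullet> k) has_real_derivative H (c t) w \<bullet> k) (at t)"
    by (simp add: has_field_derivative_def mult_commute_abs)
qed

lemma Taylor_order2:
  obtains z where "f (p + d) = f p + g p \<bullet> d + H z d \<bullet> d / 2"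
proof -
  note L = has_derivative_along[OF line_has_vector_derivative[of p d]]
  show ?thesis
    using Taylor_order2_unit_interval[OF L(1) L(3)] that by fastforce
qed

lemma continuous_on_f: "continuous_on A f"
  by (meson has_gradient has_derivative_continuous continuous_at_imp_continuous_on)

lemma partial_deriv_eq: "partial_deriv b f z = g z \<bullet> b"
  using has_derivative_along(1)[OF line_has_vector_derivative[of z b 0]]
  by (simp add: partial_deriv_def DERIV_imp_deriv)

lemma partial_deriv2_eq: "partial_deriv a (partial_deriv b f) z = H z a \<bullet> b"
proof -
  have "partial_deriv b f = (\<lambda>z. g z \<bullet> b)"
    by (simp add: fun_eq_iff partial_deriv_eq)
  then show ?thesis
    using has_derivative_along(3)[OF line_has_vector_derivative[of z a 0], of b]
    by (simp add: partial_deriv_def DERIV_imp_deriv)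
qed

end

section \<open>Existence, uniqueness and differentiability of the maximiser in the second
  variable\<close>

locale strongly_concave_snd = gradient_hessian f g H
  for f :: "'a::euclidean_space \<times> 'b::euclidean_space \<Rightarrow> real"
    and g :: "'a \<times> 'b \<Rightarrow> 'a \<times> 'b" and H :: "'a \<times> 'b \<Rightarrow> 'a \<times> 'b \<Rightarrow> 'a \<times> 'b" +
  fixes \<mu> :: real
  assumes mu_pos: "0 < \<mu>"
    and concave: "H z (0, v) \<bullet> (0, v) \<le> - \<mu> * (norm v)\<^sup>2"
begin

lemma snd_strongly_concave:
  "f (u, v') \<le> f (u, v) + snd (g (u, v)) \<bullet> (v' - v) - \<mu> / 2 * (norm (v' - v))\<^sup>2"
proof -
  obtain z where "f ((u, v) + (0, v' - v)) =
      f (u, v) + g (u, v) \<bullet> (0, v' - v) + H z (0, v' - v) \<bullet> (0, v' - v) / 2"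
    by (rule Taylor_order2)
  with concave[of z "v' - v"] show ?thesis
    by (simp add: inner_prod_def)
qed

text \<open>A maximum over a large ball exists by compactness; it is global because strong concavity
  keeps the values outside the ball below the value at 0.\<close>

lemma snd_maximum_exists: "\<exists>v. \<forall>v'. f (u, v') \<le> f (u, v)"
proof -
  \<comment> \<open>Beyond this radius the quadratic term of the concavity bound at 0 dominates the
    linear one.\<close>
  define R where "R = 2 * norm (snd (g (u, 0))) / \<mu>"
  have R: "0 \<le> R" using mu_pos by (simp add: R_def)
  have "continuous_on (cball 0 R) (\<lambda>v. f (u, v))"
    by (rule continuous_on_compose2[OF continuous_on_f[of UNIV]]) (auto intro!: continuous_intros)
  moreover have "cball 0 R \<noteq> ({} :: 'b set)" using R by simp
  ultimately obtain v where v: "\<And>v'. v' \<in> cball 0 R \<Longrightarrow> f (u, v') \<le> f (u, v)"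
    using continuous_attains_sup[OF compact_cball, of 0 R "\<lambda>v. f (u, v)"] by blast
  have "f (u, v') \<le> f (u, v)" for v'
  proof (cases "v' \<in> cball 0 R")
    case False
    have "snd (g (u, 0)) \<bullet> v' \<le> norm (snd (g (u, 0))) * norm v'"
      by (rule norm_cauchy_schwarz)
    also have "\<dots> = \<mu> / 2 * R * norm v'"
      using mu_pos by (simp add: R_def)
    also have "\<dots> \<le> \<mu> / 2 * norm v' * norm v'"
      using False mu_pos by (intro mult_right_mono mult_left_mono) auto
    finally have "f (u, v') \<le> f (u, 0)"
      using snd_strongly_concave[of u v' 0] by (simp add: power2_eq_square)
    also have "\<dots> \<le> f (u, v)" using v[of 0] R by simp
    finally show ?thesis .
  qed (use v in auto)
  then show ?thesis by blast
qed

definition argmax :: "'a \<Rightarrow> 'b" where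
  "argmax u = (SOME v. \<forall>v'. f (u, v') \<le> f (u, v))"

lemma argmax: "f (u, v) \<le> f (u, argmax u)"
  using someI_ex[OF snd_maximum_exists[of u]] by (auto simp: argmax_def)

lemma gradient_argmax: "snd (g (u, argmax u)) = 0"
proof -
  let ?v = "argmax u" and ?k = "snd (g (u, argmax u))"
  \<comment> \<open>Along the partial gradient itself the derivative is its squared norm, which must
    vanish at a maximum.\<close>
  let ?c = "\<lambda>t. (u, ?v) + t *\<^sub>R (0, ?k)"
  have "((\<lambda>t. f (?c t)) has_real_derivative g (?c 0) \<bullet> (0, ?k)) (at 0)"
    by (rule has_derivative_along(1)[OF line_has_vector_derivative])
  then have "g (?c 0) \<bullet> (0, ?k) = 0"
    by (rule DERIV_local_max[where d = 1]) (auto simp: argmax)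
  then show ?thesis
    by (simp add: inner_prod_def)
qed

text \<open>Sum of the concavity inequalities from \<open>v\<close> to the maximiser and back, the
  gradient at the maximiser contributing nothing. It controls the distance to the maximiser by the
  partial gradient at \<open>v\<close>.\<close>

lemma snd_strongly_monotone:
  "\<mu> * (norm (argmax u - v))\<^sup>2 \<le> snd (g (u, v)) \<bullet> (argmax u - v)"
proof -
  have "f (u, argmax u) \<le> f (u, v) + snd (g (u, v)) \<bullet> (argmax u - v)
      - \<mu> / 2 * (norm (argmax u - v))\<^sup>2"
    by (rule snd_strongly_concave)
  moreover have "f (u, v) \<le> f (u, argmax u) - \<mu> / 2 * (norm (v - argmax u))\<^sup>2"
    using snd_strongly_concave[of u v "argmax u"] by (simp add: gradient_argmax)
  ultimately show ?thesis by (simp add: norm_minus_commute)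
qed

lemma argmax_unique:
  assumes "\<And>v'. f (u, v') \<le> f (u, v)"
  shows "v = argmax u"
proof -
  have "f (u, argmax u) \<le> f (u, argmax u) - \<mu> / 2 * (norm (v - argmax u))\<^sup>2"
    using snd_strongly_concave[of u v "argmax u"] assms[of "argmax u"]
    by (simp add: gradient_argmax)
  then show ?thesis using mu_pos by (simp add: mult_le_0_iff)
qed

text \<open>The second diagonal block of the Hessian is negative definite, hence injective and, in
  finite dimension, surjective. The \<open>w\<close> found is the derivative of
  \<open>argmax\<close> that implicit differentiation of the first-order condition predicts.\<close>

lemma implicit_direction:
  obtains w where "\<And>v. H z (u, w) \<bullet> (0, v) = 0"
proof -
  interpret H: linear "H z" by (rule linear_H)
  define T where "T w = snd (H z (0, w))" for w
  have "linear T"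
    unfolding T_def
    by (intro linearI) (auto simp: H.add[symmetric] H.scale[symmetric] simp flip: snd_add snd_scaleR)
  moreover have "inj T"
  proof (rule linear_injective_0[THEN iffD2, OF \<open>linear T\<close>], intro allI impI)
    fix w assume "T w = 0"
    then have "0 \<le> - \<mu> * (norm w)\<^sup>2"
      using concave[of z w] by (simp add: T_def inner_prod_def)
    then show "w = 0" using mu_pos by (simp add: mult_le_0_iff)
  qed
  ultimately have "surj T" by (rule linear_inj_imp_surj)
  then obtain w where w: "T w = - snd (H z (u, 0))" by (metis surjD)
  have "H z (u, w) \<bullet> (0, v) = 0" for v
  proof -
    have "H z (u, w) = H z (u, 0) + H z (0, w)"
      by (simp add: H.add[symmetric])
    then show ?thesis using w
      by (simp add: T_def inner_prod_def inner_add_left)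
  qed
  then show thesis by (rule that)
qed

text \<open>The residual of \<open>argmax\<close> along a line is controlled by strong monotonicity at the
  predicted point, so neither the implicit function theorem nor continuity of \<open>argmax\<close> is
  needed.\<close>

lemma argmax_has_vector_derivative:
  assumes w: "\<And>v. H (a + t *\<^sub>R d, argmax (a + t *\<^sub>R d)) (d, w) \<bullet> (0, v) = 0"
  shows "((\<lambda>s. argmax (a + s *\<^sub>R d)) has_vector_derivative w) (at t)"
proof -
  let ?z = "(a + t *\<^sub>R d, argmax (a + t *\<^sub>R d))"
  \<comment> \<open>\<open>c\<close> is the line on which the maximiser is predicted to move, and
    \<open>e\<close> the first-order error of the gradient along it.\<close>
  define c where "c s = ?z + (s - t) *\<^sub>R (d, w)" for s
  define e where "e s = g (c s) - g ?z - (s - t) *\<^sub>R H ?z (d, w)" for s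
  have "(c has_vector_derivative (d, w)) (at t)"
    unfolding c_def by (auto intro!: derivative_eq_intros)
  then have "((\<lambda>s. g (c s)) has_vector_derivative H (c t) (d, w)) (at t)"
    by (rule has_derivative_along)
  then have e: "((\<lambda>s. norm (e s) / norm (s - t)) \<longlongrightarrow> 0) (at t)"
    by (simp add: has_vector_derivative_def has_derivative_iff_norm c_def e_def algebra_simps)
  \<comment> \<open>The deviation of the true maximiser from the predicted one; it has to be o(s -
    t).\<close>
  define r where "r s = argmax (a + s *\<^sub>R d) - argmax (a + t *\<^sub>R d) - (s - t) *\<^sub>R w" for s
  have bound: "\<mu> * norm (r s) \<le> norm (e s)" for s
  proof -
    have cs: "c s = (a + s *\<^sub>R d, argmax (a + t *\<^sub>R d) + (s - t) *\<^sub>R w)"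
      by (simp add: c_def algebra_simps)
    have rs: "argmax (a + s *\<^sub>R d) - (argmax (a + t *\<^sub>R d) + (s - t) *\<^sub>R w) = r s"
      by (simp add: r_def)
    have "\<mu> * (norm (r s))\<^sup>2 \<le> snd (g (c s)) \<bullet> r s"
      using snd_strongly_monotone[of "a + s *\<^sub>R d" "argmax (a + t *\<^sub>R d) + (s - t) *\<^sub>R w"]
      by (simp add: cs rs)
    \<comment> \<open>The choice of \<open>w\<close> removes the Hessian term and the partial
      gradient vanishes at the maximiser, so only \<open>e\<close> is left.\<close>
    also have "\<dots> = e s \<bullet> (0, r s)"
      using w[of "r s"] by (simp add: e_def inner_prod_def inner_diff_left gradient_argmax)
    also have "\<dots> \<le> norm (e s) * norm (r s)"
      using norm_cauchy_schwarz[of "e s" "(0, r s)"] by (simp add: norm_prod_def)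
    finally have "(\<mu> * norm (r s)) * norm (r s) \<le> norm (e s) * norm (r s)"
      by (simp add: power2_eq_square mult.assoc)
    then show ?thesis
      by (cases "r s = 0") (auto simp: mult_le_cancel_right)
  qed
  have "((\<lambda>s. norm (r s) / norm (s - t)) \<longlongrightarrow> 0) (at t)"
  proof (rule Lim_null_comparison)
    show "\<forall>\<^sub>F s in at t. norm (norm (r s) / norm (s - t)) \<le> (1 / \<mu>) * (norm (e s) / norm (s - t))"
    proof (intro always_eventually allI)
      fix s
      have "norm (r s) \<le> norm (e s) / \<mu>"
        using bound[of s] mu_pos by (simp add: field_simps)
      then have "norm (r s) / norm (s - t) \<le> norm (e s) / \<mu> / norm (s - t)"
        by (intro divide_right_mono) auto
      then show "norm (norm (r s) / norm (s - t)) \<le> (1 / \<mu>) * (norm (e s) / norm (s - t))"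
        by simp
    qed
    show "((\<lambda>s. (1 / \<mu>) * (norm (e s) / norm (s - t))) \<longlongrightarrow> 0) (at t)"
      using tendsto_mult[OF tendsto_const[of "1 / \<mu>"] e] by simp
  qed
  then show ?thesis
    by (simp add: has_vector_derivative_def has_derivative_iff_norm r_def bounded_linear_scaleR_left)
qed

text \<open>Taylor expansion of the maximum along a line. By the envelope theorem its first
  derivative contains no \<open>w\<close>, so the second derivative is obtained by differentiating
  only the gradient, with the direction \<open>(d, 0)\<close> fixed.\<close>

lemma Taylor_order2_max:
  obtains z w where "\<And>v. H z (d, w) \<bullet> (0, v) = 0"
    and "f (u + d, argmax (u + d)) =
      f (u, argmax u) + fst (g (u, argmax u)) \<bullet> d + H z (d, w) \<bullet> (d, 0) / 2"
proof -
  define c where "c t = (u + t *\<^sub>R d, argmax (u + t *\<^sub>R d))" for t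
  have "\<exists>w. \<forall>v. H (c t) (d, w) \<bullet> (0, v) = 0" for t
    using implicit_direction[of "c t" d] by metis
  then obtain w where w: "\<And>t v. H (c t) (d, w t) \<bullet> (0, v) = 0"
    by metis
  have "((\<lambda>t. argmax (u + t *\<^sub>R d)) has_vector_derivative w t) (at t)" for t
    using w[of t] by (intro argmax_has_vector_derivative) (simp add: c_def)
  then have c: "(c has_vector_derivative (d, w t)) (at t)" for t
    unfolding c_def by (intro has_vector_derivative_Pair line_has_vector_derivative)
  have g: "g (c t) \<bullet> (d, w t) = g (c t) \<bullet> (d, 0)" for t
    using gradient_argmax[of "u + t *\<^sub>R d"] by (simp add: c_def inner_prod_def)
  obtain t where "f (c 1) = f (c 0) + g (c 0) \<bullet> (d, 0) + H (c t) (d, w t) \<bullet> (d, 0) / 2"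
    using Taylor_order2_unit_interval[OF has_derivative_along(1)[OF c, unfolded g]
        has_derivative_along(3)[OF c]] by blast
  with w[of t] show thesis
    by (intro that[of "c t" "w t"]) (auto simp: c_def inner_prod_def)
qed

end

section \<open>Square roots of positive definite matrices\<close>

lemma inner_matrix_vector_transpose: "(A *v u) \<bullet> v = u \<bullet> (transpose A *v v)"
  for A :: "real ^ 'n ^ 'm"
  by (simp add: dot_lmul_matrix[symmetric] inner_commute)

text \<open>With X = S - T one has S X + X T = 0. Multiplying by X and taking traces shows that the
  traces of X S X and X T X sum to 0; both are non-negative, so both vanish, and definiteness of S
  gives X = 0.\<close>

lemma pos_definite_sqrt_unique:
  fixes S T :: "real ^ 'n ^ 'n"
  assumes S: "pos_definite S" and T: "pos_definite T" and eq: "S ** S = T ** T"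
  shows "S = T"
proof -
  define X where "X = S - T"
  have symX: "transpose X = X"
    using S T by (auto simp: X_def pos_definite_def transpose_def vec_eq_iff)
  have "S ** X + X ** T = S ** S - T ** T"
    by (simp add: X_def matrix_matrix_mult_def vec_eq_iff sum_subtractf algebra_simps)
  then have "S ** X + X ** T = 0" using eq by simp
  then have "X ** (S ** X + X ** T) = 0" by simp
  then have "trace (X ** (S ** X) + (X ** X) ** T) = 0"
    by (simp add: matrix_add_ldistrib matrix_mul_assoc trace_def)
  moreover have "trace ((X ** X) ** T) = trace (X ** (T ** X))"
    by (metis matrix_mul_assoc trace_mul_sym)
  ultimately have sum0: "trace (X ** (S ** X)) + trace (X ** (T ** X)) = 0"
    by (simp add: trace_add)
  \<comment> \<open>The trace is the sum of the values of the form \<open>R\<close> at the columns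
    of \<open>X\<close>.\<close>
  have tr: "trace (X ** (R ** X)) = (\<Sum>i\<in>UNIV. (X *v axis i 1) \<bullet> (R *v (X *v axis i 1)))" for R
  proof -
    have "(X ** (R ** X)) $ i $ i = (X *v axis i 1) \<bullet> (R *v (X *v axis i 1))" for i
    proof -
      have "(X ** (R ** X)) $ i $ i = axis i 1 \<bullet> ((X ** (R ** X)) *v axis i 1)"
        by (simp add: inner_axis' matrix_vector_mul_component column_def inner_axis)
      also have "\<dots> = (X *v axis i 1) \<bullet> (R *v (X *v axis i 1))"
        by (simp add: inner_matrix_vector_transpose symX matrix_vector_mul_assoc)
      finally show ?thesis .
    qed
    then show ?thesis by (simp add: trace_def)
  qed
  have nn: "0 \<le> v \<bullet> (R *v v)" if "pos_definite R" for R :: "real ^ 'n ^ 'n" and v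
    using that by (cases "v = 0") (auto simp: pos_definite_def less_imp_le)
  have "trace (X ** (S ** X)) = 0"
  proof -
    have "0 \<le> trace (X ** (S ** X))" "0 \<le> trace (X ** (T ** X))"
      unfolding tr by (intro sum_nonneg nn S T)+
    then show ?thesis using sum0 by linarith
  qed
  then have "\<forall>i. (X *v axis i 1) \<bullet> (S *v (X *v axis i 1)) = 0"
    unfolding tr by (subst (asm) sum_nonneg_eq_0_iff) (use nn[OF S] in auto)
  then have "\<forall>i. X *v axis i 1 = 0"
    using S unfolding pos_definite_def by (metis less_irrefl)
  then have "X = 0"
    by (simp add: matrix_vector_mul_component inner_axis vec_eq_iff)
  then show ?thesis by (simp add: X_def)
qed

text \<open>\<open>I - Y\<close> squares to \<open>I - B\<close> iff \<open>Y = (B + Y\<^sup>2) / 2\<close>, and the right-hand side is a contraction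
  of the ball of radius \<open>norm B\<close>.\<close>

lemma sqrt_near_identity:
  fixes B :: "'a::euclidean_space \<Rightarrow>\<^sub>L 'a"
  assumes norm: "norm B < 1" and sym: "\<And>u v. B u \<bullet> v = u \<bullet> B v"
  obtains Y :: "'a \<Rightarrow>\<^sub>L 'a" where "norm Y < 1" and "\<And>u v. Y u \<bullet> v = u \<bullet> Y v"
    and "\<And>v. 2 *\<^sub>R Y v = B v + Y (Y v)"
proof -
  define r where "r = norm B"
  have r: "0 \<le> r" "r < 1" using norm by (auto simp: r_def)
  define \<Phi> where "\<Phi> Y = (1/2) *\<^sub>R (B + (Y o\<^sub>L Y))" for Y :: "'a \<Rightarrow>\<^sub>L 'a"
  \<comment> \<open>Symmetry is built into the complete set, so the fixed point inherits it.\<close>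
  define K where "K = cball 0 r \<inter> (\<Inter>u v. {Y :: 'a \<Rightarrow>\<^sub>L 'a. Y u \<bullet> v = u \<bullet> Y v})"
  have "closed K"
    unfolding K_def by (intro closed_Int closed_INT ballI closed_Collect_eq continuous_intros) auto
  then have "complete K" by (simp add: complete_eq_closed)
  moreover have "0 \<in> K" using r by (simp add: K_def)
  then have "K \<noteq> {}" by blast
  moreover have "\<Phi> ` K \<subseteq> K"
  proof safe
    fix Y assume Y: "Y \<in> K"
    then have nY: "norm Y \<le> r" and sY: "\<And>u v. Y u \<bullet> v = u \<bullet> Y v" by (auto simp: K_def)
    have "norm (B + (Y o\<^sub>L Y)) \<le> norm B + norm Y * norm Y"
      by (meson norm_triangle_ineq norm_blinfun_compose add_left_mono order_trans)
    \<comment> \<open>One factor of \<open>norm Y * norm Y\<close> is bounded by 1; the factor 1/2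
      in \<open>\<Phi>\<close> then brings the sum back to \<open>r\<close>.\<close>
    also have "\<dots> \<le> r + r * 1"
      using nY r by (intro add_mono mult_mono) (auto simp: r_def)
    finally have "norm (\<Phi> Y) \<le> r" by (simp add: \<Phi>_def)
    moreover have "\<Phi> Y u \<bullet> v = u \<bullet> \<Phi> Y v" for u v
      by (simp add: \<Phi>_def blinfun.bilinear_simps inner_add_left inner_add_right sym sY)
    ultimately show "\<Phi> Y \<in> K" by (simp add: K_def)
  qed
  moreover have "dist (\<Phi> Y) (\<Phi> Z) \<le> r * dist Y Z" if "Y \<in> K" "Z \<in> K" for Y Z
  proof -
    have n: "norm Y \<le> r" "norm Z \<le> r" using that by (auto simp: K_def)
    \<comment> \<open>The non-commutative difference of squares; each of the two products
      contributes half of the contraction factor \<open>r\<close>.\<close>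
    have "\<Phi> Y - \<Phi> Z = (1/2) *\<^sub>R ((Y o\<^sub>L (Y - Z)) + ((Y - Z) o\<^sub>L Z))"
      by (rule blinfun_eqI) (simp add: \<Phi>_def blinfun.bilinear_simps algebra_simps)
    also have "norm \<dots> \<le> (norm Y * norm (Y - Z) + norm (Y - Z) * norm Z) / 2"
      using norm_triangle_ineq[of "Y o\<^sub>L (Y - Z)" "(Y - Z) o\<^sub>L Z"]
        norm_blinfun_compose[of Y "Y - Z"] norm_blinfun_compose[of "Y - Z" Z] by simp
    also have "\<dots> \<le> (r * norm (Y - Z) + norm (Y - Z) * r) / 2"
      by (intro divide_right_mono add_mono mult_mono n) (use r in auto)
    finally show ?thesis by (simp add: dist_norm)
  qed
  ultimately obtain Y where Y: "Y \<in> K" "\<Phi> Y = Y"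
    using Banach_fix[of K r \<Phi>] r by blast
  show thesis
  proof
    show "norm Y < 1" "\<And>u v. Y u \<bullet> v = u \<bullet> Y v" using Y r by (auto simp: K_def)
    fix v
    have "2 *\<^sub>R Y v = 2 *\<^sub>R \<Phi> Y v" using Y by simp
    also have "\<dots> = B v + Y (Y v)" by (simp add: \<Phi>_def blinfun.bilinear_simps)
    finally show "2 *\<^sub>R Y v = B v + Y (Y v)" .
  qed
qed

lemma mat_mult_vec: "mat a *v v = a *\<^sub>R v" for v :: "real ^ 'n"
  by (simp add: vec_eq_iff matrix_vector_mult_def mat_def if_distrib[of "\<lambda>x. x * _"] cong: if_cong)

lemma loewner_ge_mat:
  assumes "A \<succeq> mat a"
  shows "transpose A = A" and "a * (norm v)\<^sup>2 \<le> v \<bullet> (A *v v)"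
proof -
  have "transpose (A - mat a) = A - mat a" and *: "0 \<le> v \<bullet> ((A - mat a) *v v)"
    using assms by (auto simp: loewner_ge_def nonneg_definite_def)
  then have "transpose (A - mat a) + transpose (mat a) = A - mat a + mat a"
    by (simp add: transpose_mat)
  then show "transpose A = A"
    by (simp add: transpose_def vec_eq_iff)
  show "a * (norm v)\<^sup>2 \<le> v \<bullet> (A *v v)"
    using * by (simp add: matrix_vector_mult_diff_rdistrib inner_diff_right mat_mult_vec
        power2_norm_eq_inner)
qed

lemma mat_loewner_ge:
  assumes "mat a \<succeq> A"
  shows "v \<bullet> (A *v v) \<le> a * (norm v)\<^sup>2"
  using assms by (auto simp: loewner_ge_def nonneg_definite_def matrix_vector_mult_diff_rdistrib
      inner_diff_right mat_mult_vec power2_norm_eq_inner)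

text \<open>For suitable t the operator B = I - t A has norm below 1, so
  \<open>sqrt_near_identity\<close> gives a symmetric Y with (I - Y)^2 = t A. Dividing I - Y by the
  square root of t gives the root of A.\<close>

lemma pos_definite_sqrt_exists:
  fixes A :: "real ^ 'n ^ 'n"
  assumes ge: "A \<succeq> mat \<mu>" and "0 < \<mu>"
  obtains S where "pos_definite S" "A = S ** S"
proof -
  have symA: "transpose A = A" and geA: "\<And>v. \<mu> * (v \<bullet> v) \<le> v \<bullet> (A *v v)"
    using loewner_ge_mat[OF ge] by (auto simp: power2_norm_eq_inner)
  obtain L where L: "0 < L" "\<And>v. norm (A *v v) \<le> L * norm v"
    using bounded_linear.pos_bounded[OF matrix_vector_mul_bounded_linear[of A]]
    by (auto simp: mult.commute)
  \<comment> \<open>This value minimises 1 - 2 t \<mu> + t^2 L^2, the bound for the squared norm of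
    \<open>B\<close>; the minimum is the \<open>q\<close> below.\<close>
  define t where "t = \<mu> / L\<^sup>2"
  have t: "0 < t" using L \<open>0 < \<mu>\<close> by (simp add: t_def)
  define B where "B = Blinfun (\<lambda>v. v - t *\<^sub>R (A *v v))"
  have B: "blinfun_apply B v = v - t *\<^sub>R (A *v v)" for v
    unfolding B_def
    by (subst bounded_linear_Blinfun_apply)
      (auto intro!: bounded_linear_sub bounded_linear_ident bounded_linear_const_scaleR
        matrix_vector_mul_bounded_linear)
  define q where "q = 1 - \<mu>\<^sup>2 / L\<^sup>2"
  have q: "q < 1" using L \<open>0 < \<mu>\<close> by (simp add: q_def)
  have sq: "(norm (B v))\<^sup>2 \<le> q * (norm v)\<^sup>2" for v
  proof -
    have "(norm (B v))\<^sup>2 = (norm v)\<^sup>2 - 2 * t * (v \<bullet> (A *v v)) + t\<^sup>2 * (norm (A *v v))\<^sup>2"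
      unfolding power2_norm_eq_inner B
      by (simp add: inner_diff_left inner_diff_right inner_commute power2_eq_square algebra_simps)
    also have "\<dots> \<le> (norm v)\<^sup>2 - 2 * t * (\<mu> * (v \<bullet> v)) + t\<^sup>2 * (L * norm v)\<^sup>2"
      using t by (intro add_mono diff_mono mult_left_mono power_mono L geA) auto
    also have "\<dots> = q * (norm v)\<^sup>2"
      using L(1) by (simp add: t_def q_def field_simps power2_eq_square flip: power2_norm_eq_inner)
    finally show ?thesis .
  qed
  have "norm B < 1"
  proof -
    \<comment> \<open>The maximum with 0 makes the radicand non-negative without comparing \<mu>
      with \<open>L\<close>.\<close>
    have "norm (B v) \<le> sqrt (max 0 q) * norm v" for v
    proof -
      have "(norm (B v))\<^sup>2 \<le> max 0 q * (norm v)\<^sup>2"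
        using sq[of v] by (rule order_trans) (intro mult_right_mono, auto)
      from real_sqrt_le_mono[OF this] show ?thesis by (simp add: real_sqrt_mult)
    qed
    then have "norm B \<le> sqrt (max 0 q)" by (intro norm_blinfun_bound) auto
    also have "\<dots> < sqrt 1" using q by (subst real_sqrt_less_iff) auto
    finally show ?thesis by simp
  qed
  moreover have "B u \<bullet> v = u \<bullet> B v" for u v
    by (simp add: B inner_diff_left inner_diff_right inner_matrix_vector_transpose symA)
  ultimately obtain Y :: "(real ^ 'n) \<Rightarrow>\<^sub>L (real ^ 'n)" where Y: "norm Y < 1"
      "\<And>u v. Y u \<bullet> v = u \<bullet> Y v" "\<And>v. 2 *\<^sub>R Y v = B v + Y (Y v)"
    using sqrt_near_identity[of B] by metis
  define c where "c = 1 / sqrt t"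
  have c: "0 < c" "c * c * t = 1" using t by (auto simp: c_def)
  define S where "S = matrix (\<lambda>v. c *\<^sub>R (v - Y v))"
  have "linear (\<lambda>v. c *\<^sub>R (v - Y v))"
    by (intro linearI) (simp_all add: blinfun.bilinear_simps algebra_simps)
  then have S: "S *v v = c *\<^sub>R (v - Y v)" for v
    unfolding S_def by (simp add: matrix_works)
  show thesis
  proof
    have "S *v (S *v v) = A *v v" for v
    proof -
      have "S *v (S *v v) = (c * c) *\<^sub>R (v - 2 *\<^sub>R Y v + Y (Y v))"
        by (simp add: S blinfun.bilinear_simps algebra_simps scaleR_2)
      also have "\<dots> = (c * c) *\<^sub>R (t *\<^sub>R (A *v v))" by (simp add: Y(3) B)
      finally show ?thesis using c by simp
    qed
    then show "A = S ** S" by (simp add: matrix_eq matrix_vector_mul_assoc)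
    have "(transpose S *v u) \<bullet> v = (S *v u) \<bullet> v" for u v
      using Y(2)[of u v]
      by (simp add: dot_lmul_matrix S inner_diff_left inner_diff_right)
    then have "transpose S = S" by (metis matrix_eq vector_eq_rdot)
    moreover have "0 < v \<bullet> (S *v v)" if "v \<noteq> 0" for v
    proof -
      \<comment> \<open>Positivity of I - Y comes from Cauchy-Schwarz and
        \<open>norm Y < 1\<close>.\<close>
      have "v \<bullet> Y v \<le> norm v * (norm Y * norm v)"
        by (meson norm_cauchy_schwarz norm_blinfun mult_left_mono norm_ge_zero order_trans)
      also have "\<dots> < norm v * (1 * norm v)"
        using that Y(1) by (intro mult_strict_left_mono mult_strict_right_mono) auto
      also have "\<dots> = v \<bullet> v" by (simp add: dot_square_norm power2_eq_square)
      finally show ?thesis using c by (simp add: S inner_diff_right)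
    qed
    ultimately show "pos_definite S" by (simp add: pos_definite_def)
  qed
qed
lemma matrix_sqrt:
  fixes A :: "real ^ 'n ^ 'n"
  assumes "A \<succeq> mat \<mu>" and "0 < \<mu>"
  shows "pos_definite (matrix_sqrt A)" and "matrix_sqrt A ** matrix_sqrt A = A"
proof -
  obtain S where S: "pos_definite S" "A = S ** S"
    using assms by (rule pos_definite_sqrt_exists)
  have "matrix_sqrt A = S"
    unfolding matrix_sqrt_def using S by (intro the_equality) (auto intro: pos_definite_sqrt_unique)
  then show "pos_definite (matrix_sqrt A)" "matrix_sqrt A ** matrix_sqrt A = A"
    using S by auto
qed

lemma loewner_ge_pos_imp_pos_definite:
  assumes "A \<succeq> mat \<mu>" and "0 < \<mu>"
  shows "pos_definite A"
  unfolding pos_definite_def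
proof (intro conjI allI impI)
  show "transpose A = A" using assms(1) by (rule loewner_ge_mat)
  fix v :: "real ^ 'a" assume "v \<noteq> 0"
  then have "0 < \<mu> * (norm v)\<^sup>2" using \<open>0 < \<mu>\<close> by simp
  also have "\<dots> \<le> v \<bullet> (A *v v)" using assms(1) by (rule loewner_ge_mat)
  finally show "0 < v \<bullet> (A *v v)" .
qed

text \<open>\<open>matrix_inv\<close> chooses a two-sided inverse, so one has to exist; it does
  because a definite form forces a trivial kernel.\<close>

lemma pos_definite_matrix_inv:
  fixes A :: "real ^ 'n ^ 'n"
  assumes "pos_definite A"
  shows "A ** matrix_inv A = mat 1" and "matrix_inv A ** A = mat 1"
proof -
  have "v = 0" if "A *v v = 0" for v
    using assms that unfolding pos_definite_def by (metis inner_zero_right less_irrefl)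
  then obtain B where "B ** A = mat 1"
    using matrix_left_invertible_ker[of A] by blast
  then have "\<exists>A'. A ** A' = mat 1 \<and> A' ** A = mat 1"
    using matrix_left_right_inverse by blast
  then have "A ** matrix_inv A = mat 1 \<and> matrix_inv A ** A = mat 1"
    unfolding matrix_inv_def by (rule someI_ex)
  then show "A ** matrix_inv A = mat 1" "matrix_inv A ** A = mat 1" by auto
qed

lemma pos_definite_matrix_inv_vec:
  assumes "pos_definite A"
  shows "A *v (matrix_inv A *v w) = w" and "matrix_inv A *v (A *v w) = w"
  using pos_definite_matrix_inv[OF assms] by (simp_all add: matrix_vector_mul_assoc)

text \<open>Testing with a vector in the image of the root cancels both inverse roots. The matrix
  hypotheses thereby become bounds on the form of \<open>B\<close> relative to the norm of
  \<open>matrix_sqrt A *v u\<close>.\<close>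

lemma isqrt_congruence_form:
  fixes A B :: "real ^ 'n ^ 'n"
  assumes "A \<succeq> mat \<mu>" and "0 < \<mu>"
  shows "(matrix_sqrt A *v u) \<bullet> ((isqrt A ** B ** isqrt A) *v (matrix_sqrt A *v u)) = u \<bullet> (B *v u)"
proof -
  let ?S = "matrix_sqrt A"
  have S: "pos_definite ?S" using assms by (rule matrix_sqrt)
  have inv: "isqrt A *v (?S *v u) = u" "?S *v (isqrt A *v w) = w" for u w
    using pos_definite_matrix_inv_vec[OF S] by (simp_all add: isqrt_def)
  have "(?S *v u) \<bullet> ((isqrt A ** B ** isqrt A) *v (?S *v u)) = (?S *v u) \<bullet> (isqrt A *v (B *v u))"
    by (simp add: inv flip: matrix_vector_mul_assoc)
  also have "\<dots> = u \<bullet> (?S *v (isqrt A *v (B *v u)))"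
    using S by (simp add: inner_matrix_vector_transpose pos_definite_def)
  finally show ?thesis by (simp add: inv)
qed

section \<open>Hessian blocks and Schur complements\<close>

text \<open>Riesz representation: sending a functional to its vector is bounded and linear, so it
  commutes with differentiation.\<close>

lemma twice_continuously_differentiable_imp_gradient_hessian:
  fixes f :: "'a::euclidean_space \<Rightarrow> real"
  assumes "twice_continuously_differentiable f"
  obtains g H where "gradient_hessian f g H"
proof -
  obtain f' f'' where f': "\<And>z. (f has_derivative blinfun_apply (f' z)) (at z)"
    and f'': "\<And>z. (f' has_derivative blinfun_apply (f'' z)) (at z)"
    using assms unfolding twice_continuously_differentiable_def by blast
  define grad where "grad = (\<lambda>L :: 'a \<Rightarrow>\<^sub>L real. \<Sum>b\<in>Basis. blinfun_apply L b *\<^sub>R b)"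
  have grad: "grad L \<bullet> h = blinfun_apply L h" for L h
  proof -
    have "grad L \<bullet> h = blinfun_apply L (\<Sum>b\<in>Basis. (h \<bullet> b) *\<^sub>R b)"
      by (simp only: grad_def inner_sum_left blinfun.sum_right blinfun.scaleR_right inner_scaleR_left)
        (simp add: mult.commute inner_commute)
    then show ?thesis by (simp add: euclidean_representation)
  qed
  have "bounded_linear grad"
    unfolding grad_def
    by (intro bounded_linear_sum bounded_linear_compose[OF bounded_linear_scaleR_left]
        blinfun.bounded_linear_left)
  then have "((\<lambda>z. grad (f' z)) has_derivative (\<lambda>h. grad (f'' z h))) (at z)" for z
    using f'' by (rule bounded_linear.has_derivative)
  then have "gradient_hessian f (\<lambda>z. grad (f' z)) (\<lambda>z h. grad (f'' z h))"
    using f' by unfold_locales (simp_all add: grad)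
  then show thesis by (rule that)
qed

lemma matrix_vector_mult_minus: "(- A) *v v = - (A *v v)" for A :: "real ^ 'n ^ 'm"
  by (simp add: vec_eq_iff matrix_vector_mult_def sum_negf)

lemma matrix_form_eq_bilinear:
  fixes B :: "real ^ 'm \<Rightarrow> real ^ 'n \<Rightarrow> real"
  assumes l: "\<And>v. linear (\<lambda>u. B u v)" and r: "\<And>u. linear (B u)"
  shows "u \<bullet> ((\<chi> i j. B (axis i 1) (axis j 1)) *v v) = B u v"
proof -
  have lin: "L w = (\<Sum>i\<in>UNIV. w $ i * L (axis i 1))" if "linear L" for L :: "real ^ 'k \<Rightarrow> real" and w
  proof -
    have "L w = L (\<Sum>i\<in>UNIV. w $ i *\<^sub>R axis i 1)"
      using basis_expansion[of w] by (simp add: scalar_mult_eq_scaleR)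
    then show ?thesis by (simp add: linear_sum[OF that] linear_cmul[OF that])
  qed
  have "B u v = (\<Sum>i\<in>UNIV. u $ i * (\<Sum>j\<in>UNIV. v $ j * B (axis i 1) (axis j 1)))"
    by (subst lin[OF l], subst lin[OF r]) (rule refl)
  then show ?thesis
    by (simp add: inner_vec_def matrix_vector_mult_def mult.commute)
qed

context
  fixes f :: "('m::finite, 'n::finite) point \<Rightarrow> real" and g H
  assumes gh: "gradient_hessian f g H"
begin

interpretation gradient_hessian f g H by (rule gh)

lemma bilinear_hessian:
  assumes "linear P" "linear Q"
  shows "linear (\<lambda>u. H z (P u) \<bullet> Q v)" and "linear (\<lambda>v. H z (P u) \<bullet> Q v)"
proof -
  interpret H: linear "H z" by (rule linear_H)
  interpret P: linear P by fact
  interpret Q: linear Q by fact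
  show "linear (\<lambda>u. H z (P u) \<bullet> Q v)" "linear (\<lambda>v. H z (P u) \<bullet> Q v)"
    by (auto intro!: linearI simp: P.add P.scale Q.add Q.scale H.add H.scale
        inner_add_left inner_add_right)
qed

lemma linear_Pair_zero: "linear (\<lambda>u. (u, 0))" "linear (\<lambda>v. (0, v))"
  by (auto intro!: linearI)

lemma Hxx_form: "u \<bullet> (Hxx f x y *v v) = H (x, y) (u, 0) \<bullet> (v, 0)"
  unfolding Hxx_def partial_deriv2_eq ex_def
  by (rule matrix_form_eq_bilinear) (intro bilinear_hessian linear_Pair_zero)+

lemma Hxy_form: "u \<bullet> (Hxy f x y *v v) = H (x, y) (u, 0) \<bullet> (0, v)"
  unfolding Hxy_def partial_deriv2_eq ex_def ey_def
  by (rule matrix_form_eq_bilinear) (intro bilinear_hessian linear_Pair_zero)+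

lemma Hyx_form: "u \<bullet> (Hyx f x y *v v) = H (x, y) (0, u) \<bullet> (v, 0)"
  unfolding Hyx_def partial_deriv2_eq ex_def ey_def
  by (rule matrix_form_eq_bilinear) (intro bilinear_hessian linear_Pair_zero)+

lemma Hyy_form: "u \<bullet> (Hyy f x y *v v) = H (x, y) (0, u) \<bullet> (0, v)"
  unfolding Hyy_def partial_deriv2_eq ey_def
  by (rule matrix_form_eq_bilinear) (intro bilinear_hessian linear_Pair_zero)+

lemma hessian_split:
  "H z (u, w) \<bullet> k = H z (u, 0) \<bullet> k + H z (0, w) \<bullet> k"
  using linear_add[OF linear_H[of z], of "(u, 0)" "(0, w)"] by (simp add: inner_add_left)

text \<open>The correction term of the Schur complement is u . Hxy k with k = (-Hyy)^-1 Hyx u.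
  Testing the orthogonality of \<open>w\<close> with this \<open>k\<close> turns it into w . Hyx u,
  the mixed term on the left, without symmetry of the mixed second derivatives.\<close>

lemma Gxx_form:
  assumes pd: "pos_definite (- Hyy f x y)"
    and w: "\<And>v. H (x, y) (u, w) \<bullet> (0, v) = 0"
  shows "H (x, y) (u, w) \<bullet> (u, 0) = u \<bullet> (Gxx f x y *v u)"
proof -
  define k where "k = matrix_inv (- Hyy f x y) *v (Hyx f x y *v u)"
  have "- Hyy f x y *v k = Hyx f x y *v u"
    by (simp add: k_def pos_definite_matrix_inv_vec[OF pd])
  then have "w \<bullet> (Hyy f x y *v k) = - (w \<bullet> (Hyx f x y *v u))"
    by (metis inner_minus_right matrix_vector_mult_minus minus_minus)
  moreover have "u \<bullet> (Hxy f x y *v k) + w \<bullet> (Hyy f x y *v k) = 0"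
    using w[of k] by (simp add: hessian_split[of _ u w] Hxy_form Hyy_form)
  ultimately have "u \<bullet> (Hxy f x y *v k) = w \<bullet> (Hyx f x y *v u)" by simp
  then show ?thesis
    by (simp add: hessian_split[of _ u w] Gxx_def k_def matrix_vector_mult_add_rdistrib inner_add_right
        Hxx_form Hyx_form flip: matrix_vector_mul_assoc)
qed

text \<open>As for \<open>Gxx_form\<close>, now with k = Hxx^-1 Hxy u; the outer sign reflects that
  the second player works with -f.\<close>

lemma Gyy_form:
  assumes pd: "pos_definite (Hxx f x y)"
    and w: "\<And>v. H (x, y) (w, u) \<bullet> (v, 0) = 0"
  shows "- (H (x, y) (w, u) \<bullet> (0, u)) = u \<bullet> (Gyy f x y *v u)"
proof -
  define k where "k = matrix_inv (Hxx f x y) *v (Hxy f x y *v u)"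
  have "Hxx f x y *v k = Hxy f x y *v u"
    by (simp add: k_def pos_definite_matrix_inv_vec[OF pd])
  moreover have "w \<bullet> (Hxx f x y *v k) + u \<bullet> (Hyx f x y *v k) = 0"
    using w[of k] by (simp add: hessian_split[of _ w u] Hxx_form Hyx_form)
  ultimately have "u \<bullet> (Hyx f x y *v k) = - (w \<bullet> (Hxy f x y *v u))" by simp
  moreover have "u \<bullet> (Gyy f x y *v u) = - (u \<bullet> (Hyy f x y *v u)) + u \<bullet> (Hyx f x y *v k)"
    by (simp add: Gyy_def k_def matrix_vector_mult_diff_rdistrib inner_diff_right
         flip: matrix_vector_mul_assoc)
  ultimately show ?thesis
    by (simp add: hessian_split[of _ w u] Hxy_form Hyy_form)
qed

end

text \<open>Negating f and exchanging the variables turns minimisation in the first variable into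
  maximisation in the second. The swap is its own adjoint, which gives the form of the
  gradient.\<close>

lemma gradient_hessian_swap:
  assumes "gradient_hessian f g H"
  shows "gradient_hessian (\<lambda>z. - f (prod.swap z)) (\<lambda>z. - prod.swap (g (prod.swap z)))
    (\<lambda>z h. - prod.swap (H (prod.swap z) (prod.swap h)))"
proof -
  interpret gradient_hessian f g H by fact
  have swap: "bounded_linear (prod.swap :: 'd::real_normed_vector \<times> 'e::real_normed_vector \<Rightarrow> _)"
    unfolding prod.swap_def
    by (intro bounded_linear_Pair bounded_linear_fst bounded_linear_snd)
  note D = bounded_linear_imp_has_derivative[OF swap]
  show ?thesis
  proof
    fix z
    have "((\<lambda>z. - f (prod.swap z)) has_derivative (\<lambda>h. - (g (prod.swap z) \<bullet> prod.swap h))) (at z)"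
      by (intro has_derivative_minus has_derivative_compose[OF D has_gradient])
    then show "((\<lambda>z. - f (prod.swap z)) has_derivative
        (\<lambda>h. - prod.swap (g (prod.swap z)) \<bullet> h)) (at z)"
      by (simp add: inner_prod_def add.commute)
    show "((\<lambda>z. - prod.swap (g (prod.swap z))) has_derivative
        (\<lambda>h. - prod.swap (H (prod.swap z) (prod.swap h)))) (at z)"
      by (intro has_derivative_minus bounded_linear.has_derivative[OF swap]
          has_derivative_compose[OF D has_hessian])
  qed
qed

section \<open>One step in one variable\<close>

text \<open>If \<open>H z (u, w)\<close> is orthogonal to \<open>(0, v)\<close> for all \<open>v\<close>, then \<open>w\<close> is the derivative of \<open>argmax\<close>
  in direction \<open>u\<close> and \<open>H z (u, w) \<bullet> (u, 0)\<close> is the quadratic form of the Schur complement at \<open>u\<close>; the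
  assumptions \<open>schur_lower\<close> and \<open>schur_upper\<close> thus bound \<open>G\<^sub>x\<^sub>x\<close> without matrix inverses.\<close>

locale relative_bounds = strongly_concave_snd f g H \<mu>
  for f :: "'a::euclidean_space \<times> 'b::euclidean_space \<Rightarrow> real" and g H \<mu> +
  fixes S :: "'a \<Rightarrow> 'c::real_normed_vector" and \<alpha>\<^sub>H \<beta>\<^sub>H \<alpha>\<^sub>G \<beta>\<^sub>G :: real
  assumes linear_S: "linear S" and S_nonzero: "\<exists>d. S d \<noteq> 0"
    and hessian_lower: "\<alpha>\<^sub>H * (norm (S u))\<^sup>2 \<le> H z (u, 0) \<bullet> (u, 0)"
    and hessian_upper: "H z (u, 0) \<bullet> (u, 0) \<le> \<beta>\<^sub>H * (norm (S u))\<^sup>2"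
    and schur_lower: "(\<And>v. H z (u, w) \<bullet> (0, v) = 0) \<Longrightarrow>
      \<alpha>\<^sub>G * (norm (S u))\<^sup>2 \<le> H z (u, w) \<bullet> (u, 0)"
    and schur_upper: "(\<And>v. H z (u, w) \<bullet> (0, v) = 0) \<Longrightarrow>
      H z (u, w) \<bullet> (u, 0) \<le> \<beta>\<^sub>G * (norm (S u))\<^sup>2"
    and H_pos: "0 < \<alpha>\<^sub>H" "\<alpha>\<^sub>H \<le> \<beta>\<^sub>H" and G_pos: "0 < \<alpha>\<^sub>G" "\<alpha>\<^sub>G \<le> \<beta>\<^sub>G"
begin

definition maxval :: "'a \<Rightarrow> real" where
  "maxval u = f (u, argmax u)"

definition maxgrad :: "'a \<Rightarrow> 'a" where
  "maxgrad u = fst (g (u, argmax u))"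

lemma fst_lower: "f (u, v) + fst (g (u, v)) \<bullet> d + \<alpha>\<^sub>H / 2 * (norm (S d))\<^sup>2 \<le> f (u + d, v)"
  and fst_upper: "f (u + d, v) \<le> f (u, v) + fst (g (u, v)) \<bullet> d + \<beta>\<^sub>H / 2 * (norm (S d))\<^sup>2"
proof -
  obtain z where "f ((u, v) + (d, 0)) = f (u, v) + g (u, v) \<bullet> (d, 0) + H z (d, 0) \<bullet> (d, 0) / 2"
    by (rule Taylor_order2)
  then have *: "f (u + d, v) = f (u, v) + fst (g (u, v)) \<bullet> d + H z (d, 0) \<bullet> (d, 0) / 2"
    by (simp add: inner_prod_def)
  show "f (u, v) + fst (g (u, v)) \<bullet> d + \<alpha>\<^sub>H / 2 * (norm (S d))\<^sup>2 \<le> f (u + d, v)"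
    and "f (u + d, v) \<le> f (u, v) + fst (g (u, v)) \<bullet> d + \<beta>\<^sub>H / 2 * (norm (S d))\<^sup>2"
    using hessian_lower[of d z] hessian_upper[of z d] unfolding * by auto
qed

lemma maxval_lower: "maxval u + maxgrad u \<bullet> d + \<alpha>\<^sub>G / 2 * (norm (S d))\<^sup>2 \<le> maxval (u + d)"
  and maxval_upper: "maxval (u + d) \<le> maxval u + maxgrad u \<bullet> d + \<beta>\<^sub>G / 2 * (norm (S d))\<^sup>2"
proof -
  obtain z w where w: "\<And>v. H z (d, w) \<bullet> (0, v) = 0"
    and *: "maxval (u + d) = maxval u + maxgrad u \<bullet> d + H z (d, w) \<bullet> (d, 0) / 2"
    unfolding maxval_def maxgrad_def using Taylor_order2_max[of d u] by metis
  show "maxval u + maxgrad u \<bullet> d + \<alpha>\<^sub>G / 2 * (norm (S d))\<^sup>2 \<le> maxval (u + d)"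
    and "maxval (u + d) \<le> maxval u + maxgrad u \<bullet> d + \<beta>\<^sub>G / 2 * (norm (S d))\<^sup>2"
    using schur_lower[OF w] schur_upper[OF w] unfolding * by auto
qed

text \<open>For fixed v = \<open>argmax 0\<close>, f lies below the maximum function and touches it
  at 0 with the same gradient; comparing the quadratic bounds in a direction with \<open>S d\<close>
  nonzero compares the constants.\<close>

lemma alpha_H_le_beta_G: "\<alpha>\<^sub>H \<le> \<beta>\<^sub>G"
proof -
  obtain d where d: "S d \<noteq> 0" using S_nonzero by blast
  have "maxval 0 + maxgrad 0 \<bullet> d + \<alpha>\<^sub>H / 2 * (norm (S d))\<^sup>2 \<le> f (0 + d, argmax 0)"
    unfolding maxval_def maxgrad_def by (rule fst_lower)
  also have "\<dots> \<le> maxval (0 + d)" unfolding maxval_def by (rule argmax)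
  also have "\<dots> \<le> maxval 0 + maxgrad 0 \<bullet> d + \<beta>\<^sub>G / 2 * (norm (S d))\<^sup>2" by (rule maxval_upper)
  finally have "\<alpha>\<^sub>H * (norm (S d))\<^sup>2 \<le> \<beta>\<^sub>G * (norm (S d))\<^sup>2" by simp
  then show ?thesis using d by (simp add: mult_le_cancel_right)
qed

text \<open>Along the line through \<open>u\<close> in direction \<open>e\<close>, the quadratic
  majorant never falls below \<open>m\<close>, so its discriminant is not positive.\<close>

lemma maxgrad_bound:
  assumes "\<And>u. m \<le> maxval u"
  shows "(maxgrad u \<bullet> e)\<^sup>2 \<le> 2 * (maxval u - m) * (\<beta>\<^sub>G * (norm (S e))\<^sup>2)"
proof (rule quadratic_form_nonneg_imp_discriminant)
  fix t :: real
  have "m \<le> maxval u + maxgrad u \<bullet> (t *\<^sub>R e) + \<beta>\<^sub>G / 2 * (norm (S (t *\<^sub>R e)))\<^sup>2"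
    using assms maxval_upper by (rule order_trans)
  then show "0 \<le> maxval u - m + maxgrad u \<bullet> e * t + \<beta>\<^sub>G * (norm (S e))\<^sup>2 * t\<^sup>2 / 2"
    by (simp add: linear_cmul[OF linear_S] power_mult_distrib algebra_simps)
qed (use G_pos in auto)

context
  fixes xh v
  assumes xh: "\<And>u. f (xh, v) \<le> f (u, v)"
begin

lemma gradient_at_argmin: "fst (g (xh, v)) = 0"
proof -
  let ?k = "fst (g (xh, v))"
  let ?c = "\<lambda>t. (xh, v) + t *\<^sub>R (?k, 0)"
  have "((\<lambda>t. f (?c t)) has_real_derivative g (?c 0) \<bullet> (?k, 0)) (at 0)"
    by (rule has_derivative_along(1)[OF line_has_vector_derivative])
  then have "g (?c 0) \<bullet> (?k, 0) = 0"
    by (rule DERIV_local_min[where d = 1]) (auto simp: xh)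
  then show ?thesis
    by (simp add: inner_prod_def)
qed

lemma gap_lower: "\<alpha>\<^sub>H / 2 * (norm (S (u - xh)))\<^sup>2 \<le> f (u, v) - f (xh, v)"
  and gap_upper: "f (u, v) - f (xh, v) \<le> \<beta>\<^sub>H / 2 * (norm (S (u - xh)))\<^sup>2"
  using fst_lower[of xh v "u - xh"] fst_upper[of xh "u - xh" v] by (auto simp: gradient_at_argmin)

context
  fixes u xt :: 'a and m \<epsilon> \<eta> :: real
  assumes eps: "0 \<le> \<epsilon>" and eta: "0 < \<eta>"
    and xt: "f (xt, v) - f (xh, v) \<le> \<epsilon> * (f (u, v) - f (xh, v))"
    and m: "\<And>u. m \<le> maxval u"
begin

abbreviation (input) "gap \<equiv> f (u, v) - f (xh, v)"
abbreviation (input) "\<kappa> \<equiv> sqrt (\<beta>\<^sub>G / \<alpha>\<^sub>H * \<epsilon>)"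

text \<open>Here \<open>u\<close> is the current point, \<open>xh\<close> the exact response to
  \<open>v\<close> and \<open>xt\<close> the answer of the oracle. Gaps and squared norms are
  comparable by \<open>gap_lower\<close> and \<open>gap_upper\<close>; precision \<epsilon> in the
  gap becomes \<open>sqrt \<epsilon>\<close> in the norm.\<close>

lemma norm_exact_step_upper: "norm (S (xh - u)) \<le> sqrt (2 * gap / \<alpha>\<^sub>H)"
  and norm_exact_step_lower: "sqrt (2 * gap / \<beta>\<^sub>H) \<le> norm (S (xh - u))"
  and norm_oracle_error: "norm (S (xt - xh)) \<le> sqrt \<epsilon> * sqrt (2 * gap / \<alpha>\<^sub>H)"
proof -
  have flip: "norm (S (xh - u)) = norm (S (u - xh))"
    by (simp add: linear_diff[OF linear_S] norm_minus_commute)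
  show "norm (S (xh - u)) \<le> sqrt (2 * gap / \<alpha>\<^sub>H)"
    unfolding flip using gap_lower[of u] H_pos by (intro real_le_rsqrt) (simp add: field_simps)
  show "sqrt (2 * gap / \<beta>\<^sub>H) \<le> norm (S (xh - u))"
    unfolding flip using gap_upper[of u] H_pos by (intro real_le_lsqrt) (simp_all add: field_simps)
  have "\<alpha>\<^sub>H / 2 * (norm (S (xt - xh)))\<^sup>2 \<le> \<epsilon> * gap"
    using gap_lower[of xt] xt by linarith
  then show "norm (S (xt - xh)) \<le> sqrt \<epsilon> * sqrt (2 * gap / \<alpha>\<^sub>H)"
    unfolding real_sqrt_mult[symmetric]
    using H_pos by (intro real_le_rsqrt) (simp add: field_simps)
qed

lemma S_step: "S (xt - u) = S (xh - u) + S (xt - xh)"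
  by (simp add: linear_diff[OF linear_S])

lemma norm_step_upper: "(norm (S (xt - u)))\<^sup>2 \<le> (1 + sqrt \<epsilon>)\<^sup>2 * (2 * gap / \<alpha>\<^sub>H)"
proof -
  have "norm (S (xt - u)) \<le> norm (S (xh - u)) + norm (S (xt - xh))"
    unfolding S_step by (rule norm_triangle_ineq)
  also have "\<dots> \<le> (1 + sqrt \<epsilon>) * sqrt (2 * gap / \<alpha>\<^sub>H)"
    using norm_exact_step_upper norm_oracle_error by (simp add: algebra_simps)
  finally have "(norm (S (xt - u)))\<^sup>2 \<le> ((1 + sqrt \<epsilon>) * sqrt (2 * gap / \<alpha>\<^sub>H))\<^sup>2"
    by (intro power_mono) auto
  then show ?thesis
    using xh[of u] H_pos by (simp add: power_mult_distrib)
qed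

text \<open>Reverse triangle inequality. The exact step is measured through
  \<open>\<beta>\<^sub>H\<close> and the oracle error through \<open>\<alpha>\<^sub>H\<close>,
  whence their ratio under the root; the assumption makes the factor non-negative, so that squaring
  preserves the inequality.\<close>

lemma norm_step_lower:
  assumes "\<beta>\<^sub>H / \<alpha>\<^sub>H * \<epsilon> \<le> 1"
  shows "(1 - sqrt (\<beta>\<^sub>H / \<alpha>\<^sub>H * \<epsilon>))\<^sup>2 * (2 * gap / \<beta>\<^sub>H) \<le> (norm (S (xt - u)))\<^sup>2"
proof -
  have eq: "sqrt (\<beta>\<^sub>H / \<alpha>\<^sub>H * \<epsilon>) * sqrt (2 * gap / \<beta>\<^sub>H) = sqrt \<epsilon> * sqrt (2 * gap / \<alpha>\<^sub>H)"
    unfolding real_sqrt_mult[symmetric] using H_pos by (simp add: field_simps)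
  have gap: "0 \<le> 2 * gap / \<beta>\<^sub>H" using xh[of u] H_pos by simp
  have "(1 - sqrt (\<beta>\<^sub>H / \<alpha>\<^sub>H * \<epsilon>)) * sqrt (2 * gap / \<beta>\<^sub>H) \<le> norm (S (xh - u)) - norm (S (xt - xh))"
    using norm_exact_step_lower norm_oracle_error eq by (simp add: left_diff_distrib)
  also have "\<dots> \<le> norm (S (xt - u))"
    unfolding S_step by (simp add: norm_diff_ineq)
  finally have "((1 - sqrt (\<beta>\<^sub>H / \<alpha>\<^sub>H * \<epsilon>)) * sqrt (2 * gap / \<beta>\<^sub>H))\<^sup>2 \<le> (norm (S (xt - u)))\<^sup>2"
    using assms gap by (intro power_mono) auto
  then show ?thesis using gap by (simp add: power_mult_distrib)
qed

text \<open>The product of the excess p = \<open>maxval u - m\<close> and the gap is replaced by a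
  sum through 4 p gap \<le> (p + gap)^2. A bound linear in both is what can be added over the two
  players.\<close>

lemma maxgrad_oracle_error: "\<bar>maxgrad u \<bullet> (xt - xh)\<bar> \<le> \<kappa> * (maxval u - m + gap)"
proof -
  define p where "p = maxval u - m"
  have p: "0 \<le> p" using m[of u] by (simp add: p_def)
  have gap: "0 \<le> gap" using xh[of u] by simp
  have "(maxgrad u \<bullet> (xt - xh))\<^sup>2 \<le> 2 * p * (\<beta>\<^sub>G * (norm (S (xt - xh)))\<^sup>2)"
    unfolding p_def using m by (rule maxgrad_bound)
  also have "\<dots> \<le> 2 * p * (\<beta>\<^sub>G * (sqrt \<epsilon> * sqrt (2 * gap / \<alpha>\<^sub>H))\<^sup>2)"
    using p G_pos norm_oracle_error by (intro mult_left_mono power_mono) auto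
  also have "\<dots> = \<beta>\<^sub>G / \<alpha>\<^sub>H * \<epsilon> * (4 * p * gap)"
    using eps gap H_pos by (simp add: power_mult_distrib)
  also have "\<dots> \<le> \<beta>\<^sub>G / \<alpha>\<^sub>H * \<epsilon> * (p + gap)\<^sup>2"
    using eps G_pos H_pos zero_le_power2[of "p - gap"]
    by (intro mult_left_mono) (auto simp: power2_eq_square algebra_simps)
  also have "\<dots> = (\<kappa> * (p + gap))\<^sup>2"
    using eps G_pos H_pos by (simp add: power_mult_distrib)
  finally show ?thesis
    unfolding p_def[symmetric] using p gap eps G_pos H_pos
    by (subst (asm) abs_le_square_iff[symmetric]) (simp add: abs_mult)
qed

text \<open>Strong convexity of f at fixed \<open>argmax u\<close> bounds the first-order term of
  the exact step, and its quadratic surplus is worth at least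
  \<open>\<alpha>\<^sub>H / \<beta>\<^sub>H * gap\<close>. The oracle error enters through \<kappa>,
  the second-order term through \<open>norm_step_upper\<close>.\<close>

lemma maxval_step_upper:
  "maxval (u + \<eta> *\<^sub>R (xt - u)) - maxval u \<le>
    \<eta> * (f (xh, argmax u) - maxval u - \<alpha>\<^sub>H / \<beta>\<^sub>H * gap + \<kappa> * (maxval u - m + gap))
    + \<eta>\<^sup>2 * (1 + sqrt \<epsilon>)\<^sup>2 * (\<beta>\<^sub>G / \<alpha>\<^sub>H) * gap"
proof -
  have "\<alpha>\<^sub>H / \<beta>\<^sub>H * gap \<le> \<alpha>\<^sub>H / \<beta>\<^sub>H * (\<beta>\<^sub>H / 2 * (norm (S (u - xh)))\<^sup>2)"
    using gap_upper[of u] H_pos by (intro mult_left_mono) auto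
  then have "\<alpha>\<^sub>H / \<beta>\<^sub>H * gap \<le> \<alpha>\<^sub>H / 2 * (norm (S (xh - u)))\<^sup>2"
    using H_pos by (simp add: linear_diff[OF linear_S] norm_minus_commute)
  then have "maxgrad u \<bullet> (xh - u) \<le> f (xh, argmax u) - maxval u - \<alpha>\<^sub>H / \<beta>\<^sub>H * gap"
    using fst_lower[of u "argmax u" "xh - u"] by (simp add: maxval_def maxgrad_def)
  then have "maxgrad u \<bullet> (xt - u) \<le>
      f (xh, argmax u) - maxval u - \<alpha>\<^sub>H / \<beta>\<^sub>H * gap + \<kappa> * (maxval u - m + gap)"
    using maxgrad_oracle_error by (simp add: inner_diff_right)
  then have 1: "\<eta> * (maxgrad u \<bullet> (xt - u)) \<le>
      \<eta> * (f (xh, argmax u) - maxval u - \<alpha>\<^sub>H / \<beta>\<^sub>H * gap + \<kappa> * (maxval u - m + gap))"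
    using eta by (intro mult_left_mono) auto
  have "\<beta>\<^sub>G / 2 * \<eta>\<^sup>2 * (norm (S (xt - u)))\<^sup>2 \<le> \<beta>\<^sub>G / 2 * \<eta>\<^sup>2 * ((1 + sqrt \<epsilon>)\<^sup>2 * (2 * gap / \<alpha>\<^sub>H))"
    using norm_step_upper G_pos by (intro mult_left_mono) auto
  also have "\<dots> = \<eta>\<^sup>2 * (1 + sqrt \<epsilon>)\<^sup>2 * (\<beta>\<^sub>G / \<alpha>\<^sub>H) * gap"
    using H_pos by (simp add: field_simps)
  finally have 2: "\<beta>\<^sub>G / 2 * \<eta>\<^sup>2 * (norm (S (xt - u)))\<^sup>2
      \<le> \<eta>\<^sup>2 * (1 + sqrt \<epsilon>)\<^sup>2 * (\<beta>\<^sub>G / \<alpha>\<^sub>H) * gap" .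
  have "maxval (u + \<eta> *\<^sub>R (xt - u)) \<le>
      maxval u + \<eta> * (maxgrad u \<bullet> (xt - u)) + \<beta>\<^sub>G / 2 * \<eta>\<^sup>2 * (norm (S (xt - u)))\<^sup>2"
    using maxval_upper[of u "\<eta> *\<^sub>R (xt - u)"]
    by (simp add: linear_cmul[OF linear_S] power_mult_distrib mult.assoc)
  then show ?thesis using 1 2 by linarith
qed

text \<open>The reverse estimates: \<open>fst_upper\<close> for the exact step, where the quadratic
  term costs at most \<open>\<beta>\<^sub>H / \<alpha>\<^sub>H * gap\<close>, and
  \<open>norm_step_lower\<close> for the second-order gain.\<close>

lemma maxval_step_lower:
  assumes "\<beta>\<^sub>H / \<alpha>\<^sub>H * \<epsilon> \<le> 1"
  shows "\<eta> * (f (xh, argmax u) - maxval u - \<beta>\<^sub>H / \<alpha>\<^sub>H * gap - \<kappa> * (maxval u - m + gap))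
    + \<eta>\<^sup>2 * (1 - sqrt (\<beta>\<^sub>H / \<alpha>\<^sub>H * \<epsilon>))\<^sup>2 * (\<alpha>\<^sub>G / \<beta>\<^sub>H) * gap
    \<le> maxval (u + \<eta> *\<^sub>R (xt - u)) - maxval u"
proof -
  have "\<beta>\<^sub>H / \<alpha>\<^sub>H * (\<alpha>\<^sub>H / 2 * (norm (S (u - xh)))\<^sup>2) \<le> \<beta>\<^sub>H / \<alpha>\<^sub>H * gap"
    using gap_lower[of u] H_pos by (intro mult_left_mono) auto
  then have "\<beta>\<^sub>H / 2 * (norm (S (xh - u)))\<^sup>2 \<le> \<beta>\<^sub>H / \<alpha>\<^sub>H * gap"
    using H_pos by (simp add: linear_diff[OF linear_S] norm_minus_commute)
  then have "f (xh, argmax u) - maxval u - \<beta>\<^sub>H / \<alpha>\<^sub>H * gap \<le> maxgrad u \<bullet> (xh - u)"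
    using fst_upper[of u "xh - u" "argmax u"] by (simp add: maxval_def maxgrad_def)
  then have "f (xh, argmax u) - maxval u - \<beta>\<^sub>H / \<alpha>\<^sub>H * gap - \<kappa> * (maxval u - m + gap)
      \<le> maxgrad u \<bullet> (xt - u)"
    using maxgrad_oracle_error by (simp add: inner_diff_right)
  then have 1: "\<eta> * (f (xh, argmax u) - maxval u - \<beta>\<^sub>H / \<alpha>\<^sub>H * gap - \<kappa> * (maxval u - m + gap))
      \<le> \<eta> * (maxgrad u \<bullet> (xt - u))"
    using eta by (intro mult_left_mono) auto
  have "\<eta>\<^sup>2 * (1 - sqrt (\<beta>\<^sub>H / \<alpha>\<^sub>H * \<epsilon>))\<^sup>2 * (\<alpha>\<^sub>G / \<beta>\<^sub>H) * gap =
      \<alpha>\<^sub>G / 2 * \<eta>\<^sup>2 * ((1 - sqrt (\<beta>\<^sub>H / \<alpha>\<^sub>H * \<epsilon>))\<^sup>2 * (2 * gap / \<beta>\<^sub>H))"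
    using H_pos by (simp add: field_simps)
  also have "\<dots> \<le> \<alpha>\<^sub>G / 2 * \<eta>\<^sup>2 * (norm (S (xt - u)))\<^sup>2"
    using norm_step_lower[OF assms] G_pos by (intro mult_left_mono) auto
  finally have 2: "\<eta>\<^sup>2 * (1 - sqrt (\<beta>\<^sub>H / \<alpha>\<^sub>H * \<epsilon>))\<^sup>2 * (\<alpha>\<^sub>G / \<beta>\<^sub>H) * gap
      \<le> \<alpha>\<^sub>G / 2 * \<eta>\<^sup>2 * (norm (S (xt - u)))\<^sup>2" .
  have "maxval u + \<eta> * (maxgrad u \<bullet> (xt - u)) + \<alpha>\<^sub>G / 2 * \<eta>\<^sup>2 * (norm (S (xt - u)))\<^sup>2
      \<le> maxval (u + \<eta> *\<^sub>R (xt - u))"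
    using maxval_lower[of u "\<eta> *\<^sub>R (xt - u)"]
    by (simp add: linear_cmul[OF linear_S] power_mult_distrib mult.assoc)
  then show ?thesis using 1 2 by linarith
qed

end
end
end

section \<open>One step in both variables\<close>

text \<open>The second copy treats -f with exchanged variables: \<open>Y.argmax v\<close> is the
  minimiser of f(., v) and \<open>Y.maxval v\<close> is minus the minimum.\<close>

locale saddle_bounds =
  X: relative_bounds f g H \<mu> S \<alpha>\<^sub>H \<beta>\<^sub>H \<alpha>\<^sub>G \<beta>\<^sub>G +
  Y: relative_bounds "\<lambda>z. - f (prod.swap z)" "\<lambda>z. - prod.swap (g (prod.swap z))"
    "\<lambda>z h. - prod.swap (H (prod.swap z) (prod.swap h))" \<mu> T \<alpha>\<^sub>H \<beta>\<^sub>H \<alpha>\<^sub>G \<beta>\<^sub>G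
  for f :: "'a::euclidean_space \<times> 'b::euclidean_space \<Rightarrow> real" and g H \<mu>
    and S :: "'a \<Rightarrow> 'c::real_normed_vector" and T :: "'b \<Rightarrow> 'd::real_normed_vector"
    and \<alpha>\<^sub>H \<beta>\<^sub>H \<alpha>\<^sub>G \<beta>\<^sub>G +
  fixes xs ys
  assumes saddle: "global_min_max_saddle f xs ys"
begin

lemma argmin: "f (Y.argmax v, v) \<le> f (u, v)"
  using Y.argmax[of v u] by simp

lemma INF_eq: "(INF u. f (u, v)) = f (Y.argmax v, v)"
  by (rule cInf_eq_minimum) (auto simp: argmin)

lemma SUP_eq: "(SUP v. f (u, v)) = f (u, X.argmax u)"
  by (rule cSup_eq_maximum) (auto simp: X.argmax)

lemma INF_neg_eq: "(INF v. - f (u, v)) = - f (u, X.argmax u)"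
  by (rule cInf_eq_minimum) (auto simp: X.argmax)

lemma subopt_error_eq: "subopt_error f u v = X.maxval u + Y.maxval v"
  by (simp add: subopt_error_def INF_eq SUP_eq X.maxval_def Y.maxval_def)

lemma saddle_value_le: "f (xs, ys) \<le> X.maxval u" "- f (xs, ys) \<le> Y.maxval v"
proof -
  have "f (xs, ys) \<le> f (u, ys)" "f (xs, v) \<le> f (xs, ys)"
    using saddle by (auto simp: global_min_max_saddle_def)
  then show "f (xs, ys) \<le> X.maxval u" "- f (xs, ys) \<le> Y.maxval v"
    using X.argmax[of u ys] argmin[of v xs] by (simp_all add: X.maxval_def Y.maxval_def)
qed

lemma subopt_error_nonneg: "0 \<le> subopt_error f u v"
  using saddle_value_le(1)[of u] saddle_value_le(2)[of v] by (simp add: subopt_error_eq)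

text \<open>At error 0 the point is itself a saddle point. Saddle points are interchangeable:
  \<open>v\<close> and \<open>ys\<close> both maximise f(xs, .), and \<open>u\<close> and
  \<open>xs\<close> both minimise f(., ys), so uniqueness identifies them.\<close>

lemma subopt_error_pos:
  assumes "(u, v) \<noteq> (xs, ys)"
  shows "0 < subopt_error f u v"
proof (rule ccontr)
  assume "\<not> 0 < subopt_error f u v"
  then have "f (u, X.argmax u) \<le> f (Y.argmax v, v)"
    by (simp add: subopt_error_eq X.maxval_def Y.maxval_def)
  then have u: "f (u, v') \<le> f (u', v)" for u' v'
    using X.argmax[of u v'] argmin[of v u'] by linarith
  have s: "f (xs, v') \<le> f (xs, ys)" "f (xs, ys) \<le> f (u', ys)" for u' v'
    using saddle by (auto simp: global_min_max_saddle_def)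
  have "f (xs, v') \<le> f (xs, v)" for v'
    using u[of ys xs] s(1)[of v'] s(2)[of u] by linarith
  then have "v = X.argmax xs" by (rule X.argmax_unique)
  moreover have "ys = X.argmax xs" using s(1) by (rule X.argmax_unique)
  moreover have "f (u, ys) \<le> f (u', ys)" for u'
    using u[of ys xs] s(1)[of v] s(2)[of u'] by linarith
  then have "u = Y.argmax ys" by (intro Y.argmax_unique) simp
  moreover have "xs = Y.argmax ys" using s(2) by (intro Y.argmax_unique) simp
  ultimately have "(u, v) = (xs, ys)" by metis
  with assms show False ..
qed

context
  fixes u xt :: 'a and v yt :: 'b and \<epsilon> \<eta> :: real
  assumes eps: "0 \<le> \<epsilon>" and eta: "0 < \<eta>"
    and xt: "f (xt, v) - (INF u'. f (u', v)) \<le> \<epsilon> * (f (u, v) - (INF u'. f (u', v)))"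
    and yt: "- f (u, yt) - (INF v'. - f (u, v')) \<le> \<epsilon> * (- f (u, v) - (INF v'. - f (u, v')))"
begin

abbreviation (input) "E \<equiv> subopt_error f u v"
abbreviation (input) "E' \<equiv> subopt_error f (u + \<eta> *\<^sub>R (xt - u)) (v + \<eta> *\<^sub>R (yt - v))"
abbreviation (input) "\<kappa> \<equiv> sqrt (\<beta>\<^sub>G / \<alpha>\<^sub>H * \<epsilon>)"

lemma oracle_gaps:
  "f (xt, v) - f (Y.argmax v, v) \<le> \<epsilon> * (f (u, v) - f (Y.argmax v, v))"
  "- f (prod.swap (yt, u)) - - f (prod.swap (X.argmax u, u)) \<le>
     \<epsilon> * (- f (prod.swap (v, u)) - - f (prod.swap (X.argmax u, u)))"
  using xt yt by (simp_all add: INF_eq INF_neg_eq)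

lemma argmin_swap: "- f (prod.swap (X.argmax u, u)) \<le> - f (prod.swap (v', u))"
  using X.argmax by simp

text \<open>The value of f at the pair of exact responses cancels in the first sum, and its value at
  the current point cancels in the second. The gaps of the two players thus add up to the
  error.\<close>

lemma error_decomp:
  "f (Y.argmax v, X.argmax u) - X.maxval u + (- f (prod.swap (X.argmax u, Y.argmax v)) - Y.maxval v) = - E"
  "f (u, v) - f (Y.argmax v, v) + (- f (prod.swap (v, u)) - - f (prod.swap (X.argmax u, u))) = E"
  by (simp_all add: subopt_error_eq X.maxval_def Y.maxval_def)

text \<open>Sum of the two one-player bounds. The convexity terms give -1, the surpluses give the
  ratio of the constants, and \<kappa> counts twice because the excesses over the saddle value and
  the gaps each sum to the error.\<close>

lemma subopt_error_step_upper:
  "E' - E \<le> (\<eta> * (- 1 - \<alpha>\<^sub>H / \<beta>\<^sub>H + 2 * \<kappa>) + \<eta>\<^sup>2 * (1 + sqrt \<epsilon>)\<^sup>2 * (\<beta>\<^sub>G / \<alpha>\<^sub>H)) * E"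
proof -
  note X = X.maxval_step_upper[OF argmin eps eta oracle_gaps(1) saddle_value_le(1)]
  note Y = Y.maxval_step_upper[OF argmin_swap eps eta oracle_gaps(2) saddle_value_le(2)]
  define gx where "gx = f (u, v) - f (Y.argmax v, v)"
  define gy where "gy = - f (prod.swap (v, u)) - - f (prod.swap (X.argmax u, u))"
  define dx where "dx = f (Y.argmax v, X.argmax u) - X.maxval u"
  define dy where "dy = - f (prod.swap (X.argmax u, Y.argmax v)) - Y.maxval v"
  have g: "gy = E - gx" and d: "dy = - E - dx"
    using error_decomp unfolding gx_def gy_def dx_def dy_def by linarith+
  have y: "Y.maxval v = E - X.maxval u" by (simp add: subopt_error_eq)
  have split: "E' - E = X.maxval (u + \<eta> *\<^sub>R (xt - u)) - X.maxval u
      + (Y.maxval (v + \<eta> *\<^sub>R (yt - v)) - Y.maxval v)"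
    by (simp add: subopt_error_eq)
  \<comment> \<open>After eliminating the second player's quantities, \<open>dx\<close>,
    \<open>gx\<close>, \<open>p\<close> and \<open>m\<close> cancel and only the error
    \<open>e\<close> remains.\<close>
  have combine: "(\<eta> * (dx - A * gx + k * (p - m + gx)) + c * gx)
      + (\<eta> * (- e - dx - A * (e - gx) + k * (e - p - - m + (e - gx))) + c * (e - gx))
      = (\<eta> * (- 1 - A + 2 * k) + c) * e" for A k p m c e :: real
    by (simp add: algebra_simps)
  have "E' - E \<le> (\<eta> * (dx - \<alpha>\<^sub>H / \<beta>\<^sub>H * gx + \<kappa> * (X.maxval u - f (xs, ys) + gx))
      + \<eta>\<^sup>2 * (1 + sqrt \<epsilon>)\<^sup>2 * (\<beta>\<^sub>G / \<alpha>\<^sub>H) * gx) +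
      (\<eta> * (dy - \<alpha>\<^sub>H / \<beta>\<^sub>H * gy + \<kappa> * (Y.maxval v - - f (xs, ys) + gy))
      + \<eta>\<^sup>2 * (1 + sqrt \<epsilon>)\<^sup>2 * (\<beta>\<^sub>G / \<alpha>\<^sub>H) * gy)"
    unfolding split gx_def gy_def dx_def dy_def using X Y by (rule add_mono)
  also have "\<dots> = (\<eta> * (- 1 - \<alpha>\<^sub>H / \<beta>\<^sub>H + 2 * \<kappa>) + \<eta>\<^sup>2 * (1 + sqrt \<epsilon>)\<^sup>2 * (\<beta>\<^sub>G / \<alpha>\<^sub>H)) * E"
    unfolding g d y by (rule combine)
  finally show ?thesis .
qed

lemma subopt_error_step_lower:
  assumes "\<beta>\<^sub>H / \<alpha>\<^sub>H * \<epsilon> \<le> 1"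
  shows "(\<eta> * (- 1 - \<beta>\<^sub>H / \<alpha>\<^sub>H - 2 * \<kappa>)
      + \<eta>\<^sup>2 * (1 - sqrt (\<beta>\<^sub>H / \<alpha>\<^sub>H * \<epsilon>))\<^sup>2 * (\<alpha>\<^sub>G / \<beta>\<^sub>H)) * E \<le> E' - E"
proof -
  note X = X.maxval_step_lower[OF argmin eps eta oracle_gaps(1) saddle_value_le(1) assms]
  note Y = Y.maxval_step_lower[OF argmin_swap eps eta oracle_gaps(2) saddle_value_le(2) assms]
  define gx where "gx = f (u, v) - f (Y.argmax v, v)"
  define gy where "gy = - f (prod.swap (v, u)) - - f (prod.swap (X.argmax u, u))"
  define dx where "dx = f (Y.argmax v, X.argmax u) - X.maxval u"
  define dy where "dy = - f (prod.swap (X.argmax u, Y.argmax v)) - Y.maxval v"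
  define \<sigma> where "\<sigma> = sqrt (\<beta>\<^sub>H / \<alpha>\<^sub>H * \<epsilon>)"
  have g: "gy = E - gx" and d: "dy = - E - dx"
    using error_decomp unfolding gx_def gy_def dx_def dy_def by linarith+
  have y: "Y.maxval v = E - X.maxval u" by (simp add: subopt_error_eq)
  have split: "E' - E = X.maxval (u + \<eta> *\<^sub>R (xt - u)) - X.maxval u
      + (Y.maxval (v + \<eta> *\<^sub>R (yt - v)) - Y.maxval v)"
    by (simp add: subopt_error_eq)
  have combine: "(\<eta> * (- 1 - A - 2 * k) + c) * e =
      (\<eta> * (dx - A * gx - k * (p - m + gx)) + c * gx)
      + (\<eta> * (- e - dx - A * (e - gx) - k * (e - p - - m + (e - gx))) + c * (e - gx))"
    for A k p m c e :: real
    by (simp add: algebra_simps)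
  have "(\<eta> * (- 1 - \<beta>\<^sub>H / \<alpha>\<^sub>H - 2 * \<kappa>) + \<eta>\<^sup>2 * (1 - \<sigma>)\<^sup>2 * (\<alpha>\<^sub>G / \<beta>\<^sub>H)) * E =
      (\<eta> * (dx - \<beta>\<^sub>H / \<alpha>\<^sub>H * gx - \<kappa> * (X.maxval u - f (xs, ys) + gx))
      + \<eta>\<^sup>2 * (1 - \<sigma>)\<^sup>2 * (\<alpha>\<^sub>G / \<beta>\<^sub>H) * gx) +
      (\<eta> * (dy - \<beta>\<^sub>H / \<alpha>\<^sub>H * gy - \<kappa> * (Y.maxval v - - f (xs, ys) + gy))
      + \<eta>\<^sup>2 * (1 - \<sigma>)\<^sup>2 * (\<alpha>\<^sub>G / \<beta>\<^sub>H) * gy)"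
    unfolding g d y by (rule combine)
  also have "\<dots> \<le> E' - E"
    unfolding split gx_def gy_def dx_def dy_def \<sigma>_def using X Y by (rule add_mono)
  finally show ?thesis unfolding \<sigma>_def .
qed

end

end

section \<open>From the matrix inequalities to the bounds of the two-player setting\<close>

lemma inner_prod_swap: "prod.swap p \<bullet> q = p \<bullet> prod.swap q"
  by (simp add: inner_prod_def add.commute)

lemma isqrt_congruence_bounds:
  fixes A B :: "real ^ 'n ^ 'n"
  assumes "A \<succeq> mat \<mu>" and "0 < \<mu>"
    and "mat b \<succeq> isqrt A ** B ** isqrt A \<and> isqrt A ** B ** isqrt A \<succeq> mat a"
  shows "a * (norm (matrix_sqrt A *v u))\<^sup>2 \<le> u \<bullet> (B *v u)"
    and "u \<bullet> (B *v u) \<le> b * (norm (matrix_sqrt A *v u))\<^sup>2"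
  unfolding isqrt_congruence_form[OF assms(1,2), of u B, symmetric]
  using assms(3) by (blast intro: loewner_ge_mat(2) mat_loewner_ge)+

lemma pos_definite_nonzero:
  fixes S :: "real ^ 'n ^ 'n"
  assumes "pos_definite S"
  shows "\<exists>d. S *v d \<noteq> 0"
proof (rule exI, rule notI)
  let ?d = "axis undefined 1 :: real ^ 'n"
  assume "S *v ?d = 0"
  moreover have "?d \<noteq> 0" by (simp add: axis_eq_0_iff)
  ultimately show False
    using assms unfolding pos_definite_def by (metis inner_zero_right less_irrefl)
qed

text \<open>\<open>P\<close> and \<open>Q\<close> stand for the Hessian blocks at the saddle point;
  their roots define the norms of the two players. The block forms translate each matrix bound, with
  signs and components exchanged for the second player.\<close>

lemma saddle_bounds_of_matrix_bounds:
  fixes f :: "('m::finite, 'n::finite) point \<Rightarrow> real"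
  assumes gh: "gradient_hessian f g H" and \<mu>: "0 < \<mu>"
    and Hxx: "\<And>x y. Hxx f x y \<succeq> mat \<mu>" and Hyy: "\<And>x y. - Hyy f x y \<succeq> mat \<mu>"
    and saddle: "global_min_max_saddle f xs ys"
    and constants: "\<beta>\<^sub>G \<ge> \<alpha>\<^sub>G" "\<alpha>\<^sub>G > 0" "\<beta>\<^sub>H \<ge> \<alpha>\<^sub>H" "\<alpha>\<^sub>H > 0"
    and P: "P \<succeq> mat \<mu>" and Q: "Q \<succeq> mat \<mu>"
    and bound_Hxx: "\<And>u v. mat \<beta>\<^sub>H \<succeq> isqrt P ** Hxx f u v ** isqrt P \<and>
           isqrt P ** Hxx f u v ** isqrt P \<succeq> mat \<alpha>\<^sub>H"
    and bound_Hyy: "\<And>u v. mat \<beta>\<^sub>H \<succeq> isqrt Q ** (- Hyy f u v) ** isqrt Q \<and>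
           isqrt Q ** (- Hyy f u v) ** isqrt Q \<succeq> mat \<alpha>\<^sub>H"
    and bound_Gxx: "\<And>u v. mat \<beta>\<^sub>G \<succeq> isqrt P ** Gxx f u v ** isqrt P \<and>
           isqrt P ** Gxx f u v ** isqrt P \<succeq> mat \<alpha>\<^sub>G"
    and bound_Gyy: "\<And>u v. mat \<beta>\<^sub>G \<succeq> isqrt Q ** Gyy f u v ** isqrt Q \<and>
           isqrt Q ** Gyy f u v ** isqrt Q \<succeq> mat \<alpha>\<^sub>G"
  shows "saddle_bounds f g H \<mu> ((*v) (matrix_sqrt P)) ((*v) (matrix_sqrt Q)) \<alpha>\<^sub>H \<beta>\<^sub>H \<alpha>\<^sub>G \<beta>\<^sub>G xs ys"
proof -
  interpret gradient_hessian f g H by (rule gh)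
  interpret swap: gradient_hessian "\<lambda>z. - f (prod.swap z)" "\<lambda>z. - prod.swap (g (prod.swap z))"
    "\<lambda>z h. - prod.swap (H (prod.swap z) (prod.swap h))"
    by (rule gradient_hessian_swap[OF gh])
  note Hxx_form = Hxx_form[OF gh] and Hyy_form = Hyy_form[OF gh]
  note pdx = loewner_ge_pos_imp_pos_definite[OF Hxx \<mu>]
    and pdy = loewner_ge_pos_imp_pos_definite[OF Hyy \<mu>]
  note sqx = pos_definite_nonzero[OF matrix_sqrt(1)[OF P \<mu>]]
    and sqy = pos_definite_nonzero[OF matrix_sqrt(1)[OF Q \<mu>]]
  note bx = isqrt_congruence_bounds[OF P \<mu> bound_Hxx]
    and hy = isqrt_congruence_bounds[OF Q \<mu> bound_Hyy]
    and gx = isqrt_congruence_bounds[OF P \<mu> bound_Gxx]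
    and gy = isqrt_congruence_bounds[OF Q \<mu> bound_Gyy]
  show ?thesis
  proof (unfold_locales; (simp only: split_paired_all)?)
    show "0 < \<mu>" by (rule \<mu>)
    show "H (x, y) (0, v) \<bullet> (0, v) \<le> - \<mu> * (norm v)\<^sup>2" for x y v
      using loewner_ge_mat(2)[OF Hyy, of v x y] Hyy_form[of v x y v]
      by (simp add: matrix_vector_mult_minus)
    show "- prod.swap (H (prod.swap (y, x)) (prod.swap (0, v))) \<bullet> (0, v) \<le> - \<mu> * (norm v)\<^sup>2" for x y v
      using loewner_ge_mat(2)[OF Hxx, of v x y] Hxx_form[of v x y v]
      by (simp add: inner_prod_swap)
  next
    fix x y u
    show "\<alpha>\<^sub>H * (norm (matrix_sqrt P *v u))\<^sup>2 \<le> H (x, y) (u, 0) \<bullet> (u, 0)"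
      and "H (x, y) (u, 0) \<bullet> (u, 0) \<le> \<beta>\<^sub>H * (norm (matrix_sqrt P *v u))\<^sup>2"
      using bx[of u x y] by (simp_all add: Hxx_form)
  next
    fix x y u
    show "\<alpha>\<^sub>H * (norm (matrix_sqrt Q *v u))\<^sup>2 \<le>
        - prod.swap (H (prod.swap (y, x)) (prod.swap (u, 0))) \<bullet> (u, 0)"
      and "- prod.swap (H (prod.swap (y, x)) (prod.swap (u, 0))) \<bullet> (u, 0)
        \<le> \<beta>\<^sub>H * (norm (matrix_sqrt Q *v u))\<^sup>2"
      using hy[of u x y] by (simp_all add: Hyy_form matrix_vector_mult_minus inner_prod_swap)
  next
    fix x y u w assume w: "\<And>v. H (x, y) (u, w) \<bullet> (0, v) = 0"
    show "\<alpha>\<^sub>G * (norm (matrix_sqrt P *v u))\<^sup>2 \<le> H (x, y) (u, w) \<bullet> (u, 0)"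
      and "H (x, y) (u, w) \<bullet> (u, 0) \<le> \<beta>\<^sub>G * (norm (matrix_sqrt P *v u))\<^sup>2"
      using gx[of u x y] by (simp_all add: Gxx_form[OF gh pdy w])
  next
    fix x y u w
    assume "\<And>v. - prod.swap (H (prod.swap (y, x)) (prod.swap (u, w))) \<bullet> (0, v) = 0"
    then have "\<And>v. H (x, y) (w, u) \<bullet> (v, 0) = 0" by (simp add: inner_prod_swap)
    note eq = Gyy_form[OF gh pdx this]
    show "\<alpha>\<^sub>G * (norm (matrix_sqrt Q *v u))\<^sup>2 \<le>
        - prod.swap (H (prod.swap (y, x)) (prod.swap (u, w))) \<bullet> (u, 0)"
      and "- prod.swap (H (prod.swap (y, x)) (prod.swap (u, w))) \<bullet> (u, 0)
        \<le> \<beta>\<^sub>G * (norm (matrix_sqrt Q *v u))\<^sup>2"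
      using gy[of u x y] eq by (simp_all add: inner_prod_swap)
  qed (use constants sqx sqy saddle in \<open>auto simp: matrix_vector_right_distrib matrix_vector_mult_scaleR\<close>)
qed

section \<open>Convergence and divergence of the iteration\<close>

text \<open>Strictness comes from ln(1 + c) < c for nonzero c. A vanishing new error has logarithm
  minus infinity and is covered separately.\<close>

lemma log_decrease:
  fixes a b c :: real
  assumes "0 < a" "b - a \<le> c * a" "c < 0"
  shows "elog b - elog a < ereal c"
proof (cases "b \<le> 0")
  case True
  then show ?thesis using \<open>0 < a\<close> by (simp add: elog_def)
next
  case False
  have ratio: "b / a \<le> 1 + c" using assms by (simp add: field_simps)
  have pos: "0 < b / a" using False \<open>0 < a\<close> by simp
  have "ln b - ln a = ln (b / a)" using False \<open>0 < a\<close> by (simp add: ln_div)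
  also have "\<dots> \<le> ln (1 + c)" using ratio pos by simp
  also have "\<dots> < c"
    using ln_le_minus_one[of "1 + c"] ln_eq_minus_one[of "1 + c"] ratio pos \<open>c < 0\<close> by force
  finally show ?thesis using False \<open>0 < a\<close> by (simp add: elog_def)
qed

text \<open>Iterates 1 + c \<le> exp c. Working without logarithms also covers sequences that reach
  0.\<close>

lemma geometric_decay:
  fixes e :: "nat \<Rightarrow> real"
  assumes "\<And>t. 0 \<le> e t" and "\<And>t. e (Suc t) - e t \<le> c * e t"
  shows "e n \<le> exp (c * real n) * e 0"
proof (induction n)
  case (Suc n)
  have "e (Suc n) \<le> (1 + c) * e n" using assms(2)[of n] by (simp add: algebra_simps)
  also have "\<dots> \<le> exp c * e n" using assms(1) by (intro mult_right_mono exp_ge_add_one_self)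
  also have "\<dots> \<le> exp c * (exp (c * real n) * e 0)" using Suc by (intro mult_left_mono) auto
  also have "\<dots> = exp (c * real (Suc n)) * e 0" by (simp add: exp_add distrib_left)
  finally show ?case .
qed simp

lemma hitting_time_le: "z t \<in> S \<Longrightarrow> hitting_time S z \<le> enat t"
  unfolding hitting_time_def by (rule INF_lower) simp

theorem theorem3p3:
  fixes f :: "(real ^ 'm::finite) \<times> (real ^ 'n::finite) \<Rightarrow> real"
    and xs :: "real ^ 'm" and ys :: "real ^ 'n"
    and \<alpha>\<^sub>G \<beta>\<^sub>G \<alpha>\<^sub>H \<beta>\<^sub>H \<epsilon> \<eta> \<eta>_star \<eta>_bar \<gamma> :: real
    and M\<^sub>x :: "(real ^ 'm \<Rightarrow> real) \<Rightarrow> real ^ 'm \<Rightarrow> real ^ 'm"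
    and M\<^sub>y :: "(real ^ 'n \<Rightarrow> real) \<Rightarrow> real ^ 'n \<Rightarrow> real ^ 'n"
    and x :: "nat \<Rightarrow> real ^ 'm" and y :: "nat \<Rightarrow> real ^ 'n"
  assumes C2: "twice_continuously_differentiable f"
    and scc: "globally_strongly_convex_concave f"
    and saddle: "global_min_max_saddle f xs ys"
    and consts_G: "\<beta>\<^sub>G \<ge> \<alpha>\<^sub>G" "\<alpha>\<^sub>G > 0"
    and consts_H: "\<beta>\<^sub>H \<ge> \<alpha>\<^sub>H" "\<alpha>\<^sub>H > 0"
    and bound_Hxx: "\<And>u v. mat \<beta>\<^sub>H \<succeq> isqrt (Hxx f xs ys) ** Hxx f u v ** isqrt (Hxx f xs ys) \<and>
           isqrt (Hxx f xs ys) ** Hxx f u v ** isqrt (Hxx f xs ys) \<succeq> mat \<alpha>\<^sub>H"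
    and bound_Hyy: "\<And>u v. mat \<beta>\<^sub>H \<succeq> isqrt (- Hyy f xs ys) ** (- Hyy f u v) ** isqrt (- Hyy f xs ys) \<and>
           isqrt (- Hyy f xs ys) ** (- Hyy f u v) ** isqrt (- Hyy f xs ys) \<succeq> mat \<alpha>\<^sub>H"
    and bound_Gxx: "\<And>u v. mat \<beta>\<^sub>G \<succeq> isqrt (Hxx f xs ys) ** Gxx f u v ** isqrt (Hxx f xs ys) \<and>
           isqrt (Hxx f xs ys) ** Gxx f u v ** isqrt (Hxx f xs ys) \<succeq> mat \<alpha>\<^sub>G"
    and bound_Gyy: "\<And>u v. mat \<beta>\<^sub>G \<succeq> isqrt (- Hyy f xs ys) ** Gyy f u v ** isqrt (- Hyy f xs ys) \<and>
           isqrt (- Hyy f xs ys) ** Gyy f u v ** isqrt (- Hyy f xs ys) \<succeq> mat \<alpha>\<^sub>G"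
    and eps: "0 \<le> \<epsilon>" "\<epsilon> < 1" "\<epsilon> < \<alpha>\<^sub>H ^ 5 / (\<beta>\<^sub>H ^ 4 * \<beta>\<^sub>G)"
    and oracle_x: "approx_min_oracle_precision \<epsilon> (range (\<lambda>v u. f (u, v))) M\<^sub>x"
    and oracle_y: "approx_min_oracle_precision \<epsilon> (range (\<lambda>u v. - f (u, v))) M\<^sub>y"
    and eta_pos: "\<eta> > 0"
    and step_x: "\<And>t. x (Suc t) = x t + \<eta> *\<^sub>R (M\<^sub>x (\<lambda>u. f (u, y t)) (x t) - x t)"
    and step_y: "\<And>t. y (Suc t) = y t + \<eta> *\<^sub>R (M\<^sub>y (\<lambda>v. - f (x t, v)) (y t) - y t)"
    and eta_star: "\<eta>_star = (\<alpha>\<^sub>H / \<beta>\<^sub>H) * (\<alpha>\<^sub>H / \<beta>\<^sub>G) *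
           ((1 - (\<beta>\<^sub>H / \<alpha>\<^sub>H)\<^sup>2 * sqrt ((\<beta>\<^sub>G / \<alpha>\<^sub>H) * \<epsilon>)) / (1 + sqrt \<epsilon>)\<^sup>2)"
    and gamma: "\<gamma> = - 2 * \<eta> * (\<alpha>\<^sub>H / \<beta>\<^sub>H) * (1 - (\<beta>\<^sub>H\<^sup>2 / \<alpha>\<^sub>H\<^sup>2) * sqrt ((\<beta>\<^sub>G / \<alpha>\<^sub>H) * \<epsilon>))
           + \<eta>\<^sup>2 * (1 + sqrt \<epsilon>)\<^sup>2 * (\<beta>\<^sub>G / \<alpha>\<^sub>H)"
    and eta_bar: "\<eta>_bar = (\<beta>\<^sub>H / \<alpha>\<^sub>G) * (\<beta>\<^sub>H / \<alpha>\<^sub>H) *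
           ((1 + sqrt ((\<beta>\<^sub>G / \<alpha>\<^sub>H) * \<epsilon>)) / (1 - sqrt ((\<beta>\<^sub>H / \<alpha>\<^sub>H) * \<epsilon>))\<^sup>2)"
  shows "(\<eta> < 2 * \<eta>_star \<longrightarrow>
            \<gamma> < 0 \<and>
            (\<forall>t. (x t, y t) \<noteq> (xs, ys) \<longrightarrow>
               elog (subopt_error f (x (Suc t)) (y (Suc t))) - elog (subopt_error f (x t) (y t)) < ereal \<gamma>) \<and>
            (\<forall>\<zeta>. 0 < \<zeta> \<and> \<zeta> < 1 \<longrightarrow>
               hitting_time {(u, v). subopt_error f u v \<le> \<zeta> * subopt_error f (x 0) (y 0)} (\<lambda>t. (x t, y t))
                 \<le> enat (nat \<lceil>1 / \<bar>\<gamma>\<bar> * ln (1 / \<zeta>)\<rceil>)))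
       \<and> (\<eta> > 2 * \<eta>_bar \<longrightarrow>
            (\<forall>t. (x t, y t) \<noteq> (xs, ys) \<longrightarrow>
               subopt_error f (x (Suc t)) (y (Suc t)) > subopt_error f (x t) (y t)))"
proof -
  obtain g H where gh: "gradient_hessian f g H"
    using C2 by (rule twice_continuously_differentiable_imp_gradient_hessian)
  obtain \<mu> where \<mu>: "0 < \<mu>" and Hxx: "\<And>u v. Hxx f u v \<succeq> mat \<mu>"
    and Hyy: "\<And>u v. - Hyy f u v \<succeq> mat \<mu>"
    using scc by (auto simp: globally_strongly_convex_concave_def strongly_convex_concave_def)
  \<comment> \<open>The blocks at the saddle point obey the bound by \<mu> that holds everywhere, so
    \<open>Hxx\<close> and \<open>Hyy\<close> are each supplied twice.\<close>
  interpret saddle_bounds f g H \<mu> "(*v) (matrix_sqrt (Hxx f xs ys))"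
    "(*v) (matrix_sqrt (- Hyy f xs ys))" \<alpha>\<^sub>H \<beta>\<^sub>H \<alpha>\<^sub>G \<beta>\<^sub>G xs ys
    by (rule saddle_bounds_of_matrix_bounds[OF gh \<mu> Hxx Hyy saddle consts_G consts_H Hxx Hyy
          bound_Hxx bound_Hyy bound_Gxx bound_Gyy])
  define e where "e t = subopt_error f (x t) (y t)" for t
  define \<kappa> where "\<kappa> = sqrt (\<beta>\<^sub>G / \<alpha>\<^sub>H * \<epsilon>)"
  define \<sigma> where "\<sigma> = sqrt (\<beta>\<^sub>H / \<alpha>\<^sub>H * \<epsilon>)"
  have pos: "0 < \<alpha>\<^sub>H" "0 < \<beta>\<^sub>H" "0 < \<alpha>\<^sub>G" "0 < \<beta>\<^sub>G" using consts_G consts_H by auto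
  have \<kappa>: "0 \<le> \<kappa>" using pos eps by (simp add: \<kappa>_def)
  have e_nonneg: "0 \<le> e t" for t by (simp add: e_def subopt_error_nonneg)
  have e_pos: "0 < e t" if "(x t, y t) \<noteq> (xs, ys)" for t
    using that by (simp add: e_def subopt_error_pos)
  have ox: "f (M\<^sub>x (\<lambda>u. f (u, v)) u, v) - (INF u'. f (u', v)) \<le> \<epsilon> * (f (u, v) - (INF u'. f (u', v)))"
    for u v using oracle_x by (auto simp: approx_min_oracle_precision_def)
  have oy: "- f (u, M\<^sub>y (\<lambda>v. - f (u, v)) v) - (INF v'. - f (u, v'))
      \<le> \<epsilon> * (- f (u, v) - (INF v'. - f (u, v')))"
    for u v using oracle_y by (auto simp: approx_min_oracle_precision_def)
  note steps = step_x[symmetric] step_y[symmetric]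

  have upper: "e (Suc t) - e t \<le> \<gamma> * e t" for t
  proof -
    have "e (Suc t) - e t \<le>
        (\<eta> * (- 1 - \<alpha>\<^sub>H / \<beta>\<^sub>H + 2 * \<kappa>) + \<eta>\<^sup>2 * (1 + sqrt \<epsilon>)\<^sup>2 * (\<beta>\<^sub>G / \<alpha>\<^sub>H)) * e t"
      using subopt_error_step_upper[OF eps(1) eta_pos ox[of "y t" "x t"] oy[of "x t" "y t"]]
      by (simp add: steps e_def \<kappa>_def)
    also have "\<dots> \<le> \<gamma> * e t"
    proof (intro mult_right_mono e_nonneg)
      \<comment> \<open>The step estimate is at least as strong as \<gamma>: -1 is weakened to minus
        the ratio of the constants, and \<kappa> is enlarged by the inverse ratio.\<close>
      have "\<alpha>\<^sub>H / \<beta>\<^sub>H \<le> 1" and "1 \<le> \<beta>\<^sub>H / \<alpha>\<^sub>H" using pos consts_H by auto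
      then have "\<alpha>\<^sub>H / \<beta>\<^sub>H \<le> 1" and "\<kappa> \<le> \<beta>\<^sub>H / \<alpha>\<^sub>H * \<kappa>"
        using \<kappa> mult_right_mono[of 1 "\<beta>\<^sub>H / \<alpha>\<^sub>H" \<kappa>] by auto
      then have "\<eta> * (- 1 - \<alpha>\<^sub>H / \<beta>\<^sub>H + 2 * \<kappa>) \<le> \<eta> * (- 2 * (\<alpha>\<^sub>H / \<beta>\<^sub>H) + 2 * (\<beta>\<^sub>H / \<alpha>\<^sub>H * \<kappa>))"
        using eta_pos by (intro mult_left_mono) linarith+
      also have "\<dots> = - 2 * \<eta> * (\<alpha>\<^sub>H / \<beta>\<^sub>H) * (1 - \<beta>\<^sub>H\<^sup>2 / \<alpha>\<^sub>H\<^sup>2 * \<kappa>)"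
        using pos by (simp add: field_simps power2_eq_square)
      finally show "\<eta> * (- 1 - \<alpha>\<^sub>H / \<beta>\<^sub>H + 2 * \<kappa>) + \<eta>\<^sup>2 * (1 + sqrt \<epsilon>)\<^sup>2 * (\<beta>\<^sub>G / \<alpha>\<^sub>H) \<le> \<gamma>"
        unfolding gamma \<kappa>_def by linarith
    qed
    finally show ?thesis .
  qed

  have gamma_neg: "\<gamma> < 0" if "\<eta> < 2 * \<eta>_star"
  proof -
    define s where "s = (1 + sqrt \<epsilon>)\<^sup>2"
    define K where "K = 1 - \<beta>\<^sub>H\<^sup>2 / \<alpha>\<^sub>H\<^sup>2 * \<kappa>"
    have "0 < 1 + sqrt \<epsilon>" using eps by (simp add: add_pos_nonneg)
    then have s: "0 < s" by (simp add: s_def)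
    have "\<eta> < 2 * (\<alpha>\<^sub>H / \<beta>\<^sub>H * (\<alpha>\<^sub>H / \<beta>\<^sub>G) * (K / s))"
      using that by (simp add: eta_star K_def s_def \<kappa>_def power_divide)
    \<comment> \<open>As a quadratic in \<eta>, \<gamma> has the roots 0 and
      \<open>2 * \<eta>_star\<close>; clearing the denominators of \<open>\<eta>_star\<close> gives
      the sign of its second factor.\<close>
    then have "\<eta> * (s * (\<beta>\<^sub>G / \<alpha>\<^sub>H)) < 2 * (\<alpha>\<^sub>H / \<beta>\<^sub>H * (\<alpha>\<^sub>H / \<beta>\<^sub>G) * (K / s)) * (s * (\<beta>\<^sub>G / \<alpha>\<^sub>H))"
      using s pos by (intro mult_strict_right_mono) auto
    also have "\<dots> = 2 * (\<alpha>\<^sub>H / \<beta>\<^sub>H) * K" using s pos by simp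
    finally have "\<eta> * (\<eta> * (s * (\<beta>\<^sub>G / \<alpha>\<^sub>H)) - 2 * (\<alpha>\<^sub>H / \<beta>\<^sub>H) * K) < 0"
      using eta_pos by (simp add: mult_less_0_iff)
    also have "\<eta> * (\<eta> * (s * (\<beta>\<^sub>G / \<alpha>\<^sub>H)) - 2 * (\<alpha>\<^sub>H / \<beta>\<^sub>H) * K) = \<gamma>"
      unfolding gamma s_def[symmetric] \<kappa>_def[symmetric] K_def[symmetric]
      by (simp add: power2_eq_square algebra_simps)
    finally show ?thesis .
  qed

  have runtime: "hitting_time {(u, v). subopt_error f u v \<le> \<zeta> * subopt_error f (x 0) (y 0)} (\<lambda>t. (x t, y t))
      \<le> enat (nat \<lceil>1 / \<bar>\<gamma>\<bar> * ln (1 / \<zeta>)\<rceil>)" if "\<gamma> < 0" "0 < \<zeta>" for \<zeta>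
  proof (rule hitting_time_le)
    let ?n = "nat \<lceil>1 / \<bar>\<gamma>\<bar> * ln (1 / \<zeta>)\<rceil>"
    have "1 / \<bar>\<gamma>\<bar> * ln (1 / \<zeta>) \<le> real ?n" by (rule real_nat_ceiling_ge)
    \<comment> \<open>Here the absolute value of \<gamma> is -\<gamma>, and ln(1/\<zeta>) = -ln
      \<zeta>.\<close>
    then have "\<gamma> * real ?n \<le> ln \<zeta>"
      using that by (simp add: field_simps ln_div)
    then have "exp (\<gamma> * real ?n) \<le> \<zeta>"
      using \<open>0 < \<zeta>\<close> by (metis exp_le_cancel_iff exp_ln)
    then have "e ?n \<le> \<zeta> * e 0"
      using geometric_decay[of e \<gamma> ?n, OF e_nonneg upper] e_nonneg[of 0]
      by (meson mult_right_mono order_trans)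
    then show "(x ?n, y ?n) \<in> {(u, v). subopt_error f u v \<le> \<zeta> * subopt_error f (x 0) (y 0)}"
      by (simp add: e_def)
  qed

  have increase: "e t < e (Suc t)" if "2 * \<eta>_bar < \<eta>" "(x t, y t) \<noteq> (xs, ys)" for t
  proof -
    \<comment> \<open>The precision assumption keeps \<sigma> below 1, so that the denominator of
      \<open>\<eta>_bar\<close> is positive and the lower step estimate applies.\<close>
    have "\<beta>\<^sub>H / \<alpha>\<^sub>H * \<epsilon> < \<beta>\<^sub>H / \<alpha>\<^sub>H * (\<alpha>\<^sub>H ^ 5 / (\<beta>\<^sub>H ^ 4 * \<beta>\<^sub>G))"
      using eps pos by (intro mult_strict_left_mono) auto
    also have "\<dots> = (\<alpha>\<^sub>H / \<beta>\<^sub>H) ^ 3 * (\<alpha>\<^sub>H / \<beta>\<^sub>G)"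
      using pos by (simp add: field_simps eval_nat_numeral)
    also have "\<dots> \<le> 1 * 1"
      using X.alpha_H_le_beta_G consts_H pos by (intro mult_mono power_le_one) auto
    finally have ratio: "\<beta>\<^sub>H / \<alpha>\<^sub>H * \<epsilon> < 1" by simp
    then have "\<sigma> < 1" by (simp add: \<sigma>_def)
    then have s: "0 < (1 - \<sigma>)\<^sup>2" by simp
    have "2 * (\<beta>\<^sub>H / \<alpha>\<^sub>G * (\<beta>\<^sub>H / \<alpha>\<^sub>H) * ((1 + \<kappa>) / (1 - \<sigma>)\<^sup>2)) < \<eta>"
      using that(1) by (simp add: eta_bar \<kappa>_def \<sigma>_def)
    then have "2 * (\<beta>\<^sub>H / \<alpha>\<^sub>G * (\<beta>\<^sub>H / \<alpha>\<^sub>H) * ((1 + \<kappa>) / (1 - \<sigma>)\<^sup>2)) * ((1 - \<sigma>)\<^sup>2 * (\<alpha>\<^sub>G / \<beta>\<^sub>H))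
        < \<eta> * ((1 - \<sigma>)\<^sup>2 * (\<alpha>\<^sub>G / \<beta>\<^sub>H))"
      using s pos by (intro mult_strict_right_mono) auto
    also have "2 * (\<beta>\<^sub>H / \<alpha>\<^sub>G * (\<beta>\<^sub>H / \<alpha>\<^sub>H) * ((1 + \<kappa>) / (1 - \<sigma>)\<^sup>2)) * ((1 - \<sigma>)\<^sup>2 * (\<alpha>\<^sub>G / \<beta>\<^sub>H))
        = 2 * (\<beta>\<^sub>H / \<alpha>\<^sub>H) * (1 + \<kappa>)"
      using s pos by simp
    finally have 1: "2 * (\<beta>\<^sub>H / \<alpha>\<^sub>H) * (1 + \<kappa>) < \<eta> * ((1 - \<sigma>)\<^sup>2 * (\<alpha>\<^sub>G / \<beta>\<^sub>H))" .
    \<comment> \<open>Since the ratio is at least 1, it absorbs both the constant 1 and one \<kappa>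
      of the lower step estimate.\<close>
    have "1 \<le> \<beta>\<^sub>H / \<alpha>\<^sub>H" using consts_H by auto
    moreover from this have "\<kappa> \<le> \<beta>\<^sub>H / \<alpha>\<^sub>H * \<kappa>"
      using \<kappa> mult_right_mono[of 1 "\<beta>\<^sub>H / \<alpha>\<^sub>H" \<kappa>] by auto
    ultimately have "1 + \<beta>\<^sub>H / \<alpha>\<^sub>H + 2 * \<kappa> \<le> 2 * (\<beta>\<^sub>H / \<alpha>\<^sub>H) * (1 + \<kappa>)"
      unfolding distrib_left by linarith
    with 1 have "0 < \<eta> * (- 1 - \<beta>\<^sub>H / \<alpha>\<^sub>H - 2 * \<kappa> + \<eta> * ((1 - \<sigma>)\<^sup>2 * (\<alpha>\<^sub>G / \<beta>\<^sub>H)))"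
      using eta_pos by (intro mult_pos_pos) linarith+
    also have "\<dots> = \<eta> * (- 1 - \<beta>\<^sub>H / \<alpha>\<^sub>H - 2 * \<kappa>) + \<eta>\<^sup>2 * (1 - \<sigma>)\<^sup>2 * (\<alpha>\<^sub>G / \<beta>\<^sub>H)"
      by (simp add: power2_eq_square distrib_left)
    \<comment> \<open>Away from the saddle point the error is positive, which makes the increase
      strict.\<close>
    finally have "0 < (\<eta> * (- 1 - \<beta>\<^sub>H / \<alpha>\<^sub>H - 2 * \<kappa>) + \<eta>\<^sup>2 * (1 - \<sigma>)\<^sup>2 * (\<alpha>\<^sub>G / \<beta>\<^sub>H)) * e t"
      using e_pos[OF that(2)] by (rule mult_pos_pos)
    also have "\<dots> \<le> e (Suc t) - e t"
      using subopt_error_step_lower[OF eps(1) eta_pos ox[of "y t" "x t"] oy[of "x t" "y t"]] ratio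
      by (simp add: steps e_def \<kappa>_def \<sigma>_def)
    finally show ?thesis by simp
  qed

  show ?thesis
    using gamma_neg runtime increase log_decrease[OF e_pos upper] by (auto simp: e_def)
qed

end
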